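(* Let $\mathcal{S}\subset[0,D]^d$ and $\mathcal{A}\subset[0,D']^{d'}$ be finite, let $L,L'>0$, $\alpha,\alpha'>0$, and let $\Phi$ be the Lipschitz structure, i.e. the set of MDPs $\psi$ with $p_\psi(\cdot|x,a)\in\mathcal{P}(\mathcal{S})$, $q_\psi(\cdot|x,a)\in\mathcal{P}([0,1])$ such that for all $(x,a),(x',a')\in\mathcal{S}\times\mathcal{A}$, $$\|p_\psi(\cdot|x,a)-p_\psi(\cdot|x',a')\|_1\le L\,d(x,x')^\alpha+L'\,d(a,a')^{\alpha'},\qquad |r_\psi(x,a)-r_\psi(x',a')|\le L\,d(x,x')^\alpha+L'\,d(a,a')^{\alpha'}.$$ Let $\phi\in\Phi$ be ergodic. Let $\mathcal{F}_{\mathrm{lip}}(\phi)$ be the set of $\eta\in\bar{\mathbb{R}}_+^{S\times A}$ such that for all $(x',a')$ with $a'\notin\mathcal{O}(x';\phi)$, $$\sum_{x\in\mathcal{S}}\ \sum_{a\notin\mathcal{O}(x;\phi)}\eta(x,a)\left(\left[\frac{\delta^*(x',a';\phi)}{H+1}-2\big(L\,d(x,x')^\alpha+L'\,d(a,a')^{\alpha'}\big)\right]_+\right)^2\ge 2,$$ where $[u]_+=\max\{0,u\}$. Then $\mathcal{F}_{\mathrm{lip}}(\phi)\subset\mathcal{F}_\Phi(\phi)$. Furthermore, the optimal values $$K_\Phi(\phi)=\inf_{\eta\in\mathcal{F}_\Phi(\phi)}\sum_{(x,a)}\eta(x,a)\delta^*(x,a;\phi)\quad\text{and}\quad K_{\mathrm{lip}}(\phi)=\inf_{\eta\in\mathcal{F}_{\mathrm{lip}}(\phi)}\sum_{(x,a)}\eta(x,a)\delta^*(x,a;\phi)$$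 are both upper bounded by $8\frac{(H+1)^3}{\delta_{\min}^2}S_{\mathrm{lip}}A_{\mathrm{lip}}$, where $$S_{\mathrm{lip}}=\min\left\{S,\left(\frac{D\sqrt d}{\big(\frac{\delta_{\min}}{8L(H+1)}\big)^{1/\alpha}}+1\right)^{d}\right\},\qquad A_{\mathrm{lip}}=\min\left\{A,\left(\frac{D'\sqrt{d'}}{\big(\frac{\delta_{\min}}{8L'(H+1)}\big)^{1/\alpha'}}+1\right)^{d'}\right\}.$$
   Context: MDPs. $\mathcal{S}$ and $\mathcal{A}$ are finite sets of sizes $S$ and $A$. An MDP $\phi=(p_\phi,q_\phi)$ consists of transition probabilities $p_\phi(y|x,a)$ and reward distributions $q_\phi(\cdot|x,a)$ on $[0,1]$, with mean $r_\phi(x,a)$, each absolutely continuous w.r.t. a fixed measure $\lambda$ on $[0,1]$ (density also denoted $q_\phi$). $\mathcal{P}(\mathcal{S})$ is the set of distributions on $\mathcal{S}$, and $\mathcal{P}([0,1])$ the set of distributions on $[0,1]$ absolutely continuous w.r.t. $\lambda$. $d(\cdot,\cdot)$ is the Euclidean distance (in $\mathbb{R}^d$ for states, $\mathbb{R}^{d'}$ for actions), and $\|p_1-p_2\|_1=\sum_{y\in\mathcal{S}}|p_1(y)-p_2(y)|$. $X_t,A_t,R_t$ denote the state, action and reward at step $t$. Gain, bias, gaps. $\Pi_D$ is the set of stationary deterministic policies $f:\mathcal{S}\to\mathcal{A}$. $\phi$ is ergodic if under every $f\in\Pi_D$ the Markov chain $(X_t)$ is irreducible. The gain is $g_\phi^f(x)=\lim_{T\to\infty}\frac1T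 \mathbb{E}_x^f[\sum_{t=1}^T R_t]$, $g_\phi^*$ is the maximal gain (over all policies; a constant for ergodic $\phi$), and $\Pi^*(\phi)$ is the set of $f\in\Pi_D$ whose gain is maximal from every state. The bias of $f$ is $h_\phi^f(x)=\text{C-}\lim_{T\to\infty}\mathbb{E}_x^f[\sum_{t=1}^{T}(R_t-g_\phi^f(X_t))]$ (Cesàro limit), and $h_\phi^*$ is the bias function of an optimal stationary policy (unique up to an additive constant for ergodic $\phi$); its span is $H=\max_{x,y}(h_\phi^*(x)-h_\phi^*(y))$. For $h:\mathcal{S}\to\mathbb{R}$, $(\mathbf{B}_\phi^a h)(x)=r_\phi(x,a)+\sum_y p_\phi(y|x,a)h(y)$ and $(\mathbf{B}_\phi^* h)(x)=\max_{a\in\mathcal{A}}(\mathbf{B}_\phi^a h)(x)$. $\mathcal{O}(x;\phi)=\{a:(\mathbf{B}_\phi^* h_\phi^* )(x)=(\mathbf{B}_\phi^a h_\phi^* )(x)\}$, $\delta^*(x,a;\phi)=(\mathbf{B}_\phi^*h_\phi^* )(x)-(\mathbf{B}_\phi^a h_\phi^* )(x)$, and $\delta_{\min}=\min\{\delta^*(x,a;\phi):\delta^*(x,a;\phi)>0\}$ (the set being nonempty whenever $\delta_{\min}$ is used). Confusing MDPs. $\phi\ll\psi$ means that the kernels of $\phi$ are absolutely continuous w.r.t. those of $\psi$. For $\phi\ll\psi$, $$\mathrm{KL}_{\phi\mid\psi}(x,a)=\sum_{y}p_\phi(y|x,a)\log\frac{p_\phi(y|x,a)}{p_\psi(y|x,a)}+\int_0^1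 q_\phi(r|x,a)\log\frac{q_\phi(r|x,a)}{q_\psi(r|x,a)}\lambda(dr).$$ $\Delta_\Phi(\phi)$ is the set of $\psi\in\Phi$ with $\phi\ll\psi$ such that (i) $\mathrm{KL}_{\phi\mid\psi}(x,a)=0$ for all $x$ and all $a\in\mathcal{O}(x;\phi)$, and (ii) $\Pi^*(\phi)\cap\Pi^*(\psi)=\emptyset$. Then $$\mathcal{F}_\Phi(\phi)=\Big\{\eta\in\bar{\mathbb{R}}_+^{S\times A}:\ \sum_{(x,a)}\eta(x,a)\,\mathrm{KL}_{\phi\mid\psi}(x,a)\ge 1\ \ \forall\psi\in\Delta_\Phi(\phi)\Big\},$$ where $\bar{\mathbb{R}}_+=\mathbb{R}_+\cup\{\infty\}$, with $\infty\cdot 0=0$. *)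

theory Defs
  imports "HOL-Probability.Probability"
begin

section \<open>Markov decision processes with finite state and action sets\<close>

text \<open>
  The finite sets of states and actions and the reference measure on \<open>[0,1]\<close> are kept in the record, so that all notions below depend on
  the MDP only. A reward distribution is given by its density \<open>rdens \<phi> x a\<close> with
  respect to \<open>base \<phi>\<close>.
\<close>

record ('s, 'a) mdp =
  states :: "'s set"
  actions :: "'a set"
  base :: "real measure"
  tpmf :: "'s \<Rightarrow> 'a \<Rightarrow> 's pmf"
  rdens :: "'s \<Rightarrow> 'a \<Rightarrow> real \<Rightarrow> real"

definition rdistr :: "('s, 'a) mdp \<Rightarrow> 's \<Rightarrow> 'a \<Rightarrow> real measure" where
  "rdistr \<phi> x a = density (base \<phi>) (\<lambda>r. ennreal (rdens \<phi> x a r))"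

definition wf_mdp :: "('s, 'a) mdp \<Rightarrow> bool" where
  "wf_mdp \<phi> \<longleftrightarrow>
     finite (states \<phi>) \<and> states \<phi> \<noteq> {} \<and> finite (actions \<phi>) \<and> actions \<phi> \<noteq> {} \<and>
     sets (base \<phi>) = sets (restrict_space borel {0..1}) \<and>
     (\<forall>x\<in>states \<phi>. \<forall>a\<in>actions \<phi>.
        set_pmf (tpmf \<phi> x a) \<subseteq> states \<phi> \<and>
        rdens \<phi> x a \<in> borel_measurable (base \<phi>) \<and>
        (\<forall>r\<in>space (base \<phi>). 0 \<le> rdens \<phi> x a r) \<and>
        prob_space (rdistr \<phi> x a))"

definition mean_reward :: "('s, 'a) mdp \<Rightarrow> 's \<Rightarrow> 'a \<Rightarrow> real" where
  "mean_reward \<phi> x a = (\<integral>r. r * rdens \<phi> x a r \<partial>base \<phi>)"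

subsection \<open>Policies and the controlled process\<close>

text \<open>
  A trajectory is a function \<open>\<omega>\<close> with \<open>\<omega> t = (X, A, R)\<close> the state, action and reward of a
  step. Steps are numbered from \<open>0\<close>, so \<open>\<omega> t\<close> is step \<open>t + 1\<close> of the usual numbering.
\<close>

abbreviation step_space :: "('s, 'a) mdp \<Rightarrow> ('s \<times> 'a \<times> real) measure" where
  "step_space \<phi> \<equiv>
     count_space (states \<phi>) \<Otimes>\<^sub>M (count_space (actions \<phi>) \<Otimes>\<^sub>M restrict_space borel {0..1})"

abbreviation hist_space :: "('s, 'a) mdp \<Rightarrow> nat \<Rightarrow> (nat \<Rightarrow> 's \<times> 'a \<times> real) measure" where
  "hist_space \<phi> n \<equiv> PiM {0..<n} (\<lambda>_. step_space \<phi>)"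

type_synonym ('s, 'a) policy = "nat \<Rightarrow> (nat \<Rightarrow> 's \<times> 'a \<times> real) \<Rightarrow> 's \<Rightarrow> 'a measure"

text \<open>
  General policies are randomised and depend on the full history: \<open>\<pi> n h x\<close> is the law of the
  action in state \<open>x\<close> after the history \<open>h\<close> of the \<open>n\<close> preceding steps.
\<close>

definition policies :: "('s, 'a) mdp \<Rightarrow> ('s, 'a) policy set" where
  "policies \<phi> = {\<pi>. \<forall>n. case_prod (\<pi> n) \<in>
     hist_space \<phi> n \<Otimes>\<^sub>M count_space (states \<phi>) \<rightarrow>\<^sub>M prob_algebra (count_space (actions \<phi>))}"

definition det_policies :: "('s, 'a) mdp \<Rightarrow> ('s \<Rightarrow> 'a) set" where
  "det_policies \<phi> = states \<phi> \<rightarrow>\<^sub>E actions \<phi>"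

definition stationary :: "('s, 'a) mdp \<Rightarrow> ('s \<Rightarrow> 'a) \<Rightarrow> ('s, 'a) policy" where
  "stationary \<phi> f = (\<lambda>n h x. return (count_space (actions \<phi>)) (f x))"

definition next_state ::
  "('s, 'a) mdp \<Rightarrow> 's \<Rightarrow> nat \<Rightarrow> (nat \<Rightarrow> 's \<times> 'a \<times> real) \<Rightarrow> 's measure" where
  "next_state \<phi> x n h =
     (case n of
        0 \<Rightarrow> return (count_space (states \<phi>)) x
      | Suc m \<Rightarrow> restrict_space (measure_pmf (tpmf \<phi> (fst (h m)) (fst (snd (h m))))) (states \<phi>))"

definition step ::
  "('s, 'a) mdp \<Rightarrow> ('s, 'a) policy \<Rightarrow> 's \<Rightarrow> nat \<Rightarrow> (nat \<Rightarrow> 's \<times> 'a \<times> real)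
     \<Rightarrow> ('s \<times> 'a \<times> real) measure" where
  "step \<phi> \<pi> x n h =
     next_state \<phi> x n h \<bind> (\<lambda>y. \<pi> n h y \<bind> (\<lambda>a. rdistr \<phi> y a \<bind> (\<lambda>r.
       return (step_space \<phi>) (y, a, r))))"

text \<open>
  The law of the whole trajectory started in \<open>x\<close>, given by the Ionescu-Tulcea theorem. The
  premises of that theorem are checked below for well-formed MDPs and admissible policies.
\<close>

definition trajectory ::
  "('s, 'a) mdp \<Rightarrow> ('s, 'a) policy \<Rightarrow> 's \<Rightarrow> (nat \<Rightarrow> 's \<times> 'a \<times> real) measure" where
  "trajectory \<phi> \<pi> x =
     projective_family.lim UNIV (Ionescu_Tulcea.CI (step \<phi> \<pi> x) (\<lambda>_. step_space \<phi>))
       (\<lambda>_. step_space \<phi>)"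

definition state_at :: "nat \<Rightarrow> (nat \<Rightarrow> 's \<times> 'a \<times> real) \<Rightarrow> 's" where
  "state_at t \<omega> = fst (\<omega> t)"

definition reward_at :: "nat \<Rightarrow> (nat \<Rightarrow> 's \<times> 'a \<times> real) \<Rightarrow> real" where
  "reward_at t \<omega> = snd (snd (\<omega> t))"

lemma measurable_rdistr:
  assumes "wf_mdp \<phi>" "y \<in> states \<phi>" "a \<in> actions \<phi>"
  shows "rdistr \<phi> y a \<in> space (prob_algebra (restrict_space borel {0..1}))"
  using assms by (auto simp: wf_mdp_def space_prob_algebra rdistr_def)

lemma measurable_step:
  assumes wf: "wf_mdp \<phi>" and \<pi>: "\<pi> \<in> policies \<phi>" and x: "x \<in> states \<phi>"
  shows "step \<phi> \<pi> x n \<in> hist_space \<phi> n \<rightarrow>\<^sub>M prob_algebra (step_space \<phi>)"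
proof -
  have fin: "finite (states \<phi>)" "finite (actions \<phi>)"
    using wf by (auto simp: wf_mdp_def)
  have cnt: "count_space (states \<phi>) \<Otimes>\<^sub>M count_space (actions \<phi>)
      = count_space (states \<phi> \<times> actions \<phi>)"
    using fin by (rule pair_measure_count_space)
  have ns: "next_state \<phi> x n \<in> hist_space \<phi> n \<rightarrow>\<^sub>M prob_algebra (count_space (states \<phi>))"
  proof (cases n)
    case 0
    have "return (count_space (states \<phi>)) x \<in> space (prob_algebra (count_space (states \<phi>)))"
      using x by (auto simp: space_prob_algebra intro!: prob_space_return)
    then show ?thesis
      unfolding 0 next_state_def[abs_def] nat.case by (rule measurable_const)
  next
    case (Suc m)
    have "restrict_space (measure_pmf (tpmf \<phi> y a)) (states \<phi>)
        \<in> space (prob_algebra (count_space (states \<phi>)))"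
      if "y \<in> states \<phi>" "a \<in> actions \<phi>" for y a
    proof -
      have "set_pmf (tpmf \<phi> y a) \<subseteq> states \<phi>"
        using wf that by (auto simp: wf_mdp_def)
      then have "emeasure (measure_pmf (tpmf \<phi> y a)) (states \<phi>) = 1"
        by (metis measure_pmf.emeasure_eq_measure measure_pmf.prob_eq_1 AE_measure_pmf_iff
            ennreal_1 sets_measure_pmf UNIV_I subset_eq)
      moreover have "sets (restrict_space (measure_pmf (tpmf \<phi> y a)) (states \<phi>))
          = sets (count_space (states \<phi>))"
        by (auto simp: sets_restrict_space)
      ultimately show ?thesis
        by (auto simp: space_prob_algebra intro!: prob_space_restrict_space)
    qed
    then have K: "(\<lambda>(y, a). restrict_space (measure_pmf (tpmf \<phi> y a)) (states \<phi>))
        \<in> count_space (states \<phi>) \<Otimes>\<^sub>M count_space (actions \<phi>)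
          \<rightarrow>\<^sub>M prob_algebra (count_space (states \<phi>))"
      unfolding cnt by (auto simp: measurable_count_space_eq1)
    have "(\<lambda>h. (fst (h m), fst (snd (h m)))) \<in> hist_space \<phi> n
        \<rightarrow>\<^sub>M count_space (states \<phi>) \<Otimes>\<^sub>M count_space (actions \<phi>)"
      unfolding Suc by measurable
    from measurable_compose[OF this K] show ?thesis
      by (simp add: Suc next_state_def[abs_def])
  qed
  have R: "(\<lambda>(y, a). rdistr \<phi> y a) \<in> count_space (states \<phi>) \<Otimes>\<^sub>M count_space (actions \<phi>)
      \<rightarrow>\<^sub>M prob_algebra (restrict_space borel {0..1})"
    unfolding cnt using measurable_rdistr[OF wf] by (auto simp: measurable_count_space_eq1)
  have R': "(\<lambda>w. rdistr \<phi> (snd (fst w)) (snd w))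
      \<in> (hist_space \<phi> n \<Otimes>\<^sub>M count_space (states \<phi>)) \<Otimes>\<^sub>M count_space (actions \<phi>)
        \<rightarrow>\<^sub>M prob_algebra (restrict_space borel {0..1})"
  proof -
    have "(\<lambda>w. (snd (fst w), snd w)) \<in>
        (hist_space \<phi> n \<Otimes>\<^sub>M count_space (states \<phi>)) \<Otimes>\<^sub>M count_space (actions \<phi>)
        \<rightarrow>\<^sub>M count_space (states \<phi>) \<Otimes>\<^sub>M count_space (actions \<phi>)"
      by measurable
    from measurable_compose[OF this R] show ?thesis by simp
  qed
  have P: "(\<lambda>w. \<pi> n (fst w) (snd w)) \<in> hist_space \<phi> n \<Otimes>\<^sub>M count_space (states \<phi>)
      \<rightarrow>\<^sub>M prob_algebra (count_space (actions \<phi>))"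
    using \<pi> by (simp add: policies_def case_prod_beta')
  have 1: "(\<lambda>w. rdistr \<phi> (snd (fst w)) (snd w) \<bind>
        (\<lambda>r. return (step_space \<phi>) (snd (fst w), snd w, r)))
      \<in> (hist_space \<phi> n \<Otimes>\<^sub>M count_space (states \<phi>)) \<Otimes>\<^sub>M count_space (actions \<phi>)
        \<rightarrow>\<^sub>M prob_algebra (step_space \<phi>)"
    by (rule measurable_bind_prob_space2[OF R'], unfold case_prod_beta',
        rule measurable_compose[OF _ measurable_return_prob_space]) measurable
  have 2: "(\<lambda>w. \<pi> n (fst w) (snd w) \<bind> (\<lambda>a. rdistr \<phi> (snd w) a \<bind>
        (\<lambda>r. return (step_space \<phi>) (snd w, a, r))))
      \<in> hist_space \<phi> n \<Otimes>\<^sub>M count_space (states \<phi>) \<rightarrow>\<^sub>M prob_algebra (step_space \<phi>)"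
    by (rule measurable_bind_prob_space2[OF P]) (use 1 in \<open>simp add: case_prod_beta'\<close>)
  show ?thesis
    unfolding step_def[abs_def]
    by (rule measurable_bind_prob_space2[OF ns]) (use 2 in \<open>simp add: case_prod_beta'\<close>)
qed

lemma Ionescu_Tulcea_step:
  assumes "wf_mdp \<phi>" "\<pi> \<in> policies \<phi>" "x \<in> states \<phi>"
  shows "Ionescu_Tulcea (step \<phi> \<pi> x) (\<lambda>_. step_space \<phi>)"
proof (rule Ionescu_Tulcea.intro)
  show "step \<phi> \<pi> x n \<in> hist_space \<phi> n \<rightarrow>\<^sub>M subprob_algebra (step_space \<phi>)" for n
    using measurable_prob_algebraD[OF measurable_step[OF assms]] .
  show "prob_space (step \<phi> \<pi> x n h)" if "h \<in> space (hist_space \<phi> n)" for n h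
    using measurable_space[OF measurable_step[OF assms] that] by (simp add: space_prob_algebra)
qed

lemma emeasure_trajectory:
  assumes "wf_mdp \<phi>" "\<pi> \<in> policies \<phi>" "x \<in> states \<phi>"
    and "J \<subseteq> {0..<n}" "Z \<in> sets (PiM J (\<lambda>_. step_space \<phi>))"
  shows "emeasure (trajectory \<phi> \<pi> x) (prod_emb UNIV (\<lambda>_. step_space \<phi>) J Z) =
    emeasure (Ionescu_Tulcea.C (step \<phi> \<pi> x) (\<lambda>_. step_space \<phi>) 0 n (\<lambda>_. undefined))
      (prod_emb {0..<n} (\<lambda>_. step_space \<phi>) J Z)"
proof -
  interpret IT: Ionescu_Tulcea "step \<phi> \<pi> x" "\<lambda>_. step_space \<phi>"
    by (rule Ionescu_Tulcea_step[OF assms(1-3)])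
  have "finite J"
    using assms(4) finite_subset by blast
  from IT.lim[OF this assms(5)] IT.emeasure_CI[OF assms(4,5)] show ?thesis
    by (simp add: trajectory_def)
qed

lemma prob_space_trajectory:
  assumes "wf_mdp \<phi>" "\<pi> \<in> policies \<phi>" "x \<in> states \<phi>"
  shows "prob_space (trajectory \<phi> \<pi> x)"
proof
  interpret IT: Ionescu_Tulcea "step \<phi> \<pi> x" "\<lambda>_. step_space \<phi>"
    by (rule Ionescu_Tulcea_step[OF assms])
  interpret C: prob_space
    "Ionescu_Tulcea.C (step \<phi> \<pi> x) (\<lambda>_. step_space \<phi>) 0 0 (\<lambda>_. undefined)"
    by (rule IT.prob_space_C) simp
  have sp: "space (trajectory \<phi> \<pi> x) =
      prod_emb UNIV (\<lambda>_. step_space \<phi>) {} (space (PiM {} (\<lambda>_. step_space \<phi>)))"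
    by (simp add: trajectory_def prod_emb_def space_PiM) (auto simp: restrict_def)
  have sp': "prod_emb {0..<0} (\<lambda>_. step_space \<phi>) {} (space (PiM {} (\<lambda>_. step_space \<phi>))) =
      space (Ionescu_Tulcea.C (step \<phi> \<pi> x) (\<lambda>_. step_space \<phi>) 0 0 (\<lambda>_. undefined))"
    by (auto simp: IT.space_C prod_emb_def space_PiM)
  show "emeasure (trajectory \<phi> \<pi> x) (space (trajectory \<phi> \<pi> x)) = 1"
    unfolding sp
    by (subst emeasure_trajectory[OF assms, of "{}" 0], simp, simp, unfold sp', rule C.emeasure_space_1)
qed

lemma stationary_in_policies:
  assumes "wf_mdp \<phi>" "f \<in> det_policies \<phi>"
  shows "stationary \<phi> f \<in> policies \<phi>"
proof -
  have "(\<lambda>w. f (snd w)) \<in> hist_space \<phi> n \<Otimes>\<^sub>M count_space (states \<phi>) \<rightarrow>\<^sub>M count_space (actions \<phi>)"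
    for n
    using assms(2)
    by (intro measurable_compose[OF measurable_snd]) (auto simp: det_policies_def)
  from measurable_compose[OF this measurable_return_prob_space] show ?thesis
    by (simp add: policies_def stationary_def case_prod_beta')
qed

subsection \<open>Ergodicity, gain, bias and gaps\<close>

definition ergodic :: "('s, 'a) mdp \<Rightarrow> bool" where
  "ergodic \<phi> \<longleftrightarrow>
     (\<forall>f\<in>det_policies \<phi>. \<forall>x\<in>states \<phi>. \<forall>y\<in>states \<phi>. \<exists>t.
        0 < \<P>(\<omega> in trajectory \<phi> (stationary \<phi> f) x. state_at t \<omega> = y))"

definition total_reward :: "('s, 'a) mdp \<Rightarrow> ('s, 'a) policy \<Rightarrow> 's \<Rightarrow> nat \<Rightarrow> real" where
  "total_reward \<phi> \<pi> x T = (\<integral>\<omega>. (\<Sum>t<T. reward_at t \<omega>) \<partial>trajectory \<phi> \<pi> x)"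

definition gain :: "('s, 'a) mdp \<Rightarrow> ('s \<Rightarrow> 'a) \<Rightarrow> 's \<Rightarrow> real" where
  "gain \<phi> f x = lim (\<lambda>T. total_reward \<phi> (stationary \<phi> f) x T / real T)"

text \<open>The average reward of a general policy need not converge, hence the lower limit.\<close>

definition opt_gain :: "('s, 'a) mdp \<Rightarrow> 's \<Rightarrow> ereal" where
  "opt_gain \<phi> x = (SUP \<pi>\<in>policies \<phi>. liminf (\<lambda>T. ereal (total_reward \<phi> \<pi> x T / real T)))"

definition opt_policies :: "('s, 'a) mdp \<Rightarrow> ('s \<Rightarrow> 'a) set" where
  "opt_policies \<phi> = {f \<in> det_policies \<phi>. \<forall>x\<in>states \<phi>. ereal (gain \<phi> f x) = opt_gain \<phi> x}"

text \<open>The Cesaro limit of a sequence indexed from \<open>1\<close>.\<close>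

definition cesaro_lim :: "(nat \<Rightarrow> real) \<Rightarrow> real" where
  "cesaro_lim u = lim (\<lambda>N. (\<Sum>T=1..N. u T) / real N)"

definition bias :: "('s, 'a) mdp \<Rightarrow> ('s \<Rightarrow> 'a) \<Rightarrow> 's \<Rightarrow> real" where
  "bias \<phi> f x = cesaro_lim (\<lambda>T.
     \<integral>\<omega>. (\<Sum>t<T. reward_at t \<omega> - gain \<phi> f (state_at t \<omega>)) \<partial>trajectory \<phi> (stationary \<phi> f) x)"

text \<open>
  For an ergodic MDP the bias functions of the optimal policies differ by additive constants only,
  and these cancel in all notions derived from \<open>opt_bias\<close>, so any optimal policy may be chosen.
\<close>

definition opt_bias :: "('s, 'a) mdp \<Rightarrow> 's \<Rightarrow> real" where
  "opt_bias \<phi> = bias \<phi> (SOME f. f \<in> opt_policies \<phi>)"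

definition bias_span :: "('s, 'a) mdp \<Rightarrow> real" where
  "bias_span \<phi> = Max {opt_bias \<phi> x - opt_bias \<phi> y | x y. x \<in> states \<phi> \<and> y \<in> states \<phi>}"

definition bellman :: "('s, 'a) mdp \<Rightarrow> 'a \<Rightarrow> ('s \<Rightarrow> real) \<Rightarrow> 's \<Rightarrow> real" where
  "bellman \<phi> a h x = mean_reward \<phi> x a + (\<Sum>y\<in>states \<phi>. pmf (tpmf \<phi> x a) y * h y)"

definition opt_bellman :: "('s, 'a) mdp \<Rightarrow> ('s \<Rightarrow> real) \<Rightarrow> 's \<Rightarrow> real" where
  "opt_bellman \<phi> h x = (MAX a\<in>actions \<phi>. bellman \<phi> a h x)"

definition opt_actions :: "('s, 'a) mdp \<Rightarrow> 's \<Rightarrow> 'a set" where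
  "opt_actions \<phi> x =
     {a \<in> actions \<phi>. opt_bellman \<phi> (opt_bias \<phi>) x = bellman \<phi> a (opt_bias \<phi>) x}"

definition gap :: "('s, 'a) mdp \<Rightarrow> 's \<Rightarrow> 'a \<Rightarrow> real" where
  "gap \<phi> x a = opt_bellman \<phi> (opt_bias \<phi>) x - bellman \<phi> a (opt_bias \<phi>) x"

definition pos_gaps :: "('s, 'a) mdp \<Rightarrow> real set" where
  "pos_gaps \<phi> = {gap \<phi> x a | x a. x \<in> states \<phi> \<and> a \<in> actions \<phi> \<and> 0 < gap \<phi> x a}"

definition min_gap :: "('s, 'a) mdp \<Rightarrow> real" where
  "min_gap \<phi> = Min (pos_gaps \<phi>)"

subsection \<open>Confusing MDPs and feasible exploration rates\<close>

definition mdp_ac :: "('s, 'a) mdp \<Rightarrow> ('s, 'a) mdp \<Rightarrow> bool" where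
  "mdp_ac \<phi> \<psi> \<longleftrightarrow>
     (\<forall>x\<in>states \<phi>. \<forall>a\<in>actions \<phi>.
        absolutely_continuous (measure_pmf (tpmf \<psi> x a)) (measure_pmf (tpmf \<phi> x a)) \<and>
        absolutely_continuous (rdistr \<psi> x a) (rdistr \<phi> x a))"

text \<open>
  The integral of a function whose negative part is integrable, with value in \<open>(-\<infinity>, \<infinity>]\<close>. The
  Bochner integral, on which \<^const>\<open>KL_divergence\<close> is based, would yield \<open>0\<close> where the
  divergence of two reward distributions is infinite.
\<close>

definition ext_integral :: "'b measure \<Rightarrow> ('b \<Rightarrow> real) \<Rightarrow> ereal" where
  "ext_integral M f = enn2ereal (\<integral>\<^sup>+r. ennreal (f r) \<partial>M) - enn2ereal (\<integral>\<^sup>+r. ennreal (- f r) \<partial>M)"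

definition kl :: "('s, 'a) mdp \<Rightarrow> ('s, 'a) mdp \<Rightarrow> 's \<Rightarrow> 'a \<Rightarrow> ereal" where
  "kl \<phi> \<psi> x a =
     ereal (\<Sum>y\<in>states \<phi>.
       pmf (tpmf \<phi> x a) y * ln (pmf (tpmf \<phi> x a) y / pmf (tpmf \<psi> x a) y)) +
     ext_integral (base \<phi>) (\<lambda>r. rdens \<phi> x a r * ln (rdens \<phi> x a r / rdens \<psi> x a r))"

definition confusing :: "('s, 'a) mdp set \<Rightarrow> ('s, 'a) mdp \<Rightarrow> ('s, 'a) mdp set" where
  "confusing \<Phi> \<phi> = {\<psi> \<in> \<Phi>. mdp_ac \<phi> \<psi> \<and>
     (\<forall>x\<in>states \<phi>. \<forall>a\<in>opt_actions \<phi> x. kl \<phi> \<psi> x a = 0) \<and>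
     opt_policies \<phi> \<inter> opt_policies \<psi> = {}}"

text \<open>On \<^typ>\<open>ereal\<close>, \<open>\<infinity> * 0 = 0\<close>.\<close>

definition feasible :: "('s, 'a) mdp set \<Rightarrow> ('s, 'a) mdp \<Rightarrow> ('s \<times> 'a \<Rightarrow> ereal) set" where
  "feasible \<Phi> \<phi> = {\<eta> \<in> states \<phi> \<times> actions \<phi> \<rightarrow>\<^sub>E {0..}.
     \<forall>\<psi>\<in>confusing \<Phi> \<phi>. (\<Sum>(x, a)\<in>states \<phi> \<times> actions \<phi>. \<eta> (x, a) * kl \<phi> \<psi> x a) \<ge> 1}"

definition opt_value :: "('s, 'a) mdp \<Rightarrow> ('s \<times> 'a \<Rightarrow> ereal) set \<Rightarrow> ereal" where
  "opt_value \<phi> F =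
     (INF \<eta>\<in>F. \<Sum>(x, a)\<in>states \<phi> \<times> actions \<phi>. \<eta> (x, a) * ereal (gap \<phi> x a))"

subsection \<open>The Lipschitz structure\<close>

definition lip_bound ::
  "real \<Rightarrow> real \<Rightarrow> real \<Rightarrow> real \<Rightarrow> 's::metric_space \<Rightarrow> 'a::metric_space \<Rightarrow> 's \<Rightarrow> 'a \<Rightarrow> real" where
  "lip_bound L L' \<alpha> \<alpha>' x a x' a' = L * dist x x' powr \<alpha> + L' * dist a a' powr \<alpha>'"

definition lipschitz_mdps ::
  "'s::metric_space set \<Rightarrow> 'a::metric_space set \<Rightarrow> real measure \<Rightarrow>
   real \<Rightarrow> real \<Rightarrow> real \<Rightarrow> real \<Rightarrow> ('s, 'a) mdp set" where
  "lipschitz_mdps S A lam L L' \<alpha> \<alpha>' =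
     {\<psi>. wf_mdp \<psi> \<and> states \<psi> = S \<and> actions \<psi> = A \<and> base \<psi> = lam \<and>
        (\<forall>x\<in>S. \<forall>a\<in>A. \<forall>x'\<in>S. \<forall>a'\<in>A.
           (\<Sum>y\<in>S. \<bar>pmf (tpmf \<psi> x a) y - pmf (tpmf \<psi> x' a') y\<bar>) \<le> lip_bound L L' \<alpha> \<alpha>' x a x' a' \<and>
           \<bar>mean_reward \<psi> x a - mean_reward \<psi> x' a'\<bar> \<le> lip_bound L L' \<alpha> \<alpha>' x a x' a')}"

definition lip_feasible ::
  "real \<Rightarrow> real \<Rightarrow> real \<Rightarrow> real \<Rightarrow> ('s::metric_space, 'a::metric_space) mdp \<Rightarrow>
   ('s \<times> 'a \<Rightarrow> ereal) set" where
  "lip_feasible L L' \<alpha> \<alpha>' \<phi> = {\<eta> \<in> states \<phi> \<times> actions \<phi> \<rightarrow>\<^sub>E {0..}.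
     \<forall>x'\<in>states \<phi>. \<forall>a'\<in>actions \<phi> - opt_actions \<phi> x'.
       (\<Sum>x\<in>states \<phi>. \<Sum>a\<in>actions \<phi> - opt_actions \<phi> x.
          \<eta> (x, a) * ereal ((max 0 (gap \<phi> x' a' / (bias_span \<phi> + 1)
                                      - 2 * lip_bound L L' \<alpha> \<alpha>' x a x' a'))\<^sup>2)) \<ge> 2}"

definition cover_size :: "nat \<Rightarrow> real \<Rightarrow> nat \<Rightarrow> real \<Rightarrow> real" where
  "cover_size m D d \<rho> = min (real m) ((D * sqrt (real d) / \<rho> + 1) ^ d)"

end

theory Submission
  imports Defs
begin

text \<open>
  Let \<open>h\<close> be the optimal bias of \<open>\<phi>\<close>. If no action of a confusing \<open>\<psi>\<close> improved on \<open>h\<close>, an optimal policy of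
  \<open>\<phi>\<close> would satisfy the optimality equation of \<open>\<psi>\<close> and be optimal there. Hence at some suboptimal
  \<open>(x', a')\<close> the kernels of \<open>\<psi>\<close> and \<open>\<phi>\<close> differ by at least \<open>gap / (H + 1)\<close>, in mean reward or in total
  variation. The Lipschitz condition on both MDPs transports this to every \<open>(x, a)\<close> at the cost of
  twice the Lipschitz bound, and a Pinsker-type inequality turns it into a lower bound on the divergence.
  For the value, put the constant rate \<open>8 (H + 1)\<^sup>2 / \<delta>\<^sup>2\<close> on one suboptimal pair per cell of a partition
  into sets of small diameter; gaps are at most \<open>H + 1\<close>.
\<close>

section \<open>Finite Markov kernels\<close>

text \<open>Optimality is measured against all randomised history-dependent policies, while
  \<open>opt_bias\<close> is a Cesaro limit for one arbitrarily chosen optimal policy. That it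
  solves the optimality equation has to be derived: irreducibility makes Poisson's equation
  solvable, the bias solves it up to a constant, and a policy of maximal gain admits no improving
  action in any state. A confusing MDP need not be ergodic, so its own bias is never formed: a gain
  and a function solving its optimality equation certify optimality, and those of
  \<open>\<phi>\<close> are tried.

  The factor H + 1 under the gap arises since Bellman values at \<open>h\<close> differ by at most
  the reward difference plus H times half the total transition difference, hence by H + 1 times the
  larger of the two. The cells are chosen such that each of the two Lipschitz terms is at most
  \<delta> / (8 (H + 1)); twice their sum uses up half of \<delta> / (H + 1), the square of the
  remaining half is \<delta>^2 / (4 (H + 1)^2), and the threshold 2 then dictates the rate. The
  third power of H + 1 comes from bounding each gap in the objective.\<close>

definition avg_op :: "'s set \<Rightarrow> ('s \<Rightarrow> 's \<Rightarrow> real) \<Rightarrow> ('s \<Rightarrow> real) \<Rightarrow> 's \<Rightarrow> real" where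
  "avg_op S P h x = (\<Sum>y\<in>S. P x y * h y)"

locale finite_kernel =
  fixes S :: "'s set" and P :: "'s \<Rightarrow> 's \<Rightarrow> real"
  assumes finite_S: "finite S" and S_nonempty: "S \<noteq> {}"
    and P_nonneg: "x \<in> S \<Longrightarrow> y \<in> S \<Longrightarrow> 0 \<le> P x y"
    and P_sum: "x \<in> S \<Longrightarrow> (\<Sum>y\<in>S. P x y) = 1"
begin

abbreviation K where "K \<equiv> avg_op S P"

lemma K_cong: "(\<And>y. y \<in> S \<Longrightarrow> h y = h' y) \<Longrightarrow> K h x = K h' x"
  by (simp add: avg_op_def)

lemma K_const: "x \<in> S \<Longrightarrow> K (\<lambda>_. c) x = c"
  by (simp add: avg_op_def P_sum flip: sum_distrib_right)

lemma K_add: "K (\<lambda>y. h y + h' y) x = K h x + K h' x"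
  by (simp add: avg_op_def distrib_left sum.distrib)

lemma K_diff: "K (\<lambda>y. h y - h' y) x = K h x - K h' x"
  by (simp add: avg_op_def right_diff_distrib sum_subtractf)

lemma K_scale: "K (\<lambda>y. c * h y) x = c * K h x"
  by (simp add: avg_op_def sum_distrib_left mult_ac)

lemma K_mono: "x \<in> S \<Longrightarrow> (\<And>y. y \<in> S \<Longrightarrow> h y \<le> h' y) \<Longrightarrow> K h x \<le> K h' x"
  by (auto simp: avg_op_def intro!: sum_mono mult_left_mono P_nonneg)

lemma K_funpow_mono:
  assumes "\<And>y. y \<in> S \<Longrightarrow> h y \<le> h' y" "x \<in> S"
  shows "(K ^^ n) h x \<le> (K ^^ n) h' x"
  using assms(2) by (induction n arbitrary: x) (auto simp: assms(1) intro!: K_mono)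

lemma K_funpow_affine:
  assumes "x \<in> S"
  shows "(K ^^ n) (\<lambda>y. c + d * h y) x = c + d * (K ^^ n) h x"
  using assms
proof (induction n arbitrary: x)
  case (Suc n)
  have "(K ^^ Suc n) (\<lambda>y. c + d * h y) x = K (\<lambda>y. c + d * (K ^^ n) h y) x"
    by (simp, rule K_cong, rule Suc.IH)
  then show ?case
    by (simp add: K_add K_scale K_const Suc.prems)
qed simp

lemma K_funpow_bound:
  assumes "\<And>y. y \<in> S \<Longrightarrow> \<bar>h y\<bar> \<le> c" "x \<in> S"
  shows "\<bar>(K ^^ n) h x\<bar> \<le> c"
proof -
  \<comment> \<open>The factor 0 writes the constant functions in the affine form whose iterates are
    already computed.\<close>
  have "(K ^^ n) h x \<le> (K ^^ n) (\<lambda>y. c + 0 * h y) x" "(K ^^ n) (\<lambda>y. - c + 0 * h y) x \<le> (K ^^ n) h x"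
    using assms by (auto intro!: K_funpow_mono) (fastforce simp: abs_le_iff)+
  then show ?thesis
    using K_funpow_affine[OF assms(2), of n c 0 h] K_funpow_affine[OF assms(2), of n "- c" 0 h] by simp
qed

lemma K_funpow_superharmonic:
  assumes "\<And>x. x \<in> S \<Longrightarrow> K u x \<le> u x" "x \<in> S"
  shows "(K ^^ n) u x \<le> u x"
  using assms(2)
proof (induction n arbitrary: x)
  case (Suc n)
  have "(K ^^ Suc n) u x \<le> K u x"
    using Suc by (auto intro: K_mono)
  with assms(1)[OF Suc.prems] show ?case by simp
qed simp

lemma bounded_on_S: "\<exists>c\<ge>0. \<forall>x\<in>S. \<bar>h x :: real\<bar> \<le> c"
  by (intro exI[of _ "\<Sum>x\<in>S. \<bar>h x\<bar>"]) (auto intro!: sum_nonneg member_le_sum finite_S)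

text \<open>On \<open>S\<close> the reward is g + h - K h. Applying \<open>K ^^ t\<close> fixes the
  constant and leaves a difference of consecutive iterates, so sums over \<open>t\<close>
  collapse.\<close>

lemma K_funpow_telescope:
  assumes "\<And>x. x \<in> S \<Longrightarrow> g + h x = r x + K h x" "x \<in> S"
  shows "(K ^^ t) r x = g + (K ^^ t) h x - (K ^^ Suc t) h x"
  using assms(2)
proof (induction t arbitrary: x)
  case 0
  then show ?case using assms(1)[of x] by simp
next
  case (Suc t)
  have "(K ^^ Suc t) r x = K (\<lambda>x. g + (K ^^ t) h x - (K ^^ Suc t) h x) x"
    unfolding funpow.simps(2)[of t K] o_def by (rule K_cong) (use Suc.IH in simp)
  then show ?case
    by (simp add: K_diff K_add K_const Suc.prems)
qed

lemma K_funpow_sum: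
  assumes "\<And>x. x \<in> S \<Longrightarrow> g + h x = r x + K h x" "x \<in> S"
  shows "(\<Sum>t<T. (K ^^ t) r x) = real T * g + h x - (K ^^ T) h x"
  by (induction T) (simp_all add: K_funpow_telescope[OF assms] algebra_simps)

text \<open>For a periodic kernel \<open>(K ^^ T) h\<close> may oscillate forever, but it stays
  bounded, and this is enough after division by \<open>T\<close>.\<close>

lemma K_funpow_average:
  assumes "\<And>x. x \<in> S \<Longrightarrow> g + h x = r x + K h x" "x \<in> S"
  shows "(\<lambda>T. (\<Sum>t<T. (K ^^ t) r x) / real T) \<longlonglongrightarrow> g"
proof -
  obtain c where c: "\<And>x. x \<in> S \<Longrightarrow> \<bar>h x\<bar> \<le> c" using bounded_on_S by blast
  have "(\<lambda>T. (h x - (K ^^ T) h x) / real T) \<longlonglongrightarrow> 0"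
  proof (rule Lim_null_comparison)
    have "norm ((h x - (K ^^ T) h x) / real T) \<le> 2 * c / real T" for T
      using c[OF assms(2)] K_funpow_bound[of h c x T, OF c assms(2)]
      by (auto simp: intro!: divide_right_mono)
    then show "\<forall>\<^sub>F T in sequentially. norm ((h x - (K ^^ T) h x) / real T) \<le> 2 * c / real T"
      by simp
    show "(\<lambda>T. 2 * c / real T) \<longlonglongrightarrow> 0" by (rule lim_const_over_n)
  qed
  from tendsto_add[OF tendsto_const[of g] this]
  have "(\<lambda>T. g + (h x - (K ^^ T) h x) / real T) \<longlonglongrightarrow> g" by simp
  \<comment> \<open>The two sequences agree only from T = 1 on: at T = 0 the quotient is 0 by the
    convention for division.\<close>
  then show ?thesis
    by (rule Lim_transform_eventually)
       (auto simp: K_funpow_sum[OF assms] field_simps intro!: eventually_sequentiallyI[of 1])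
qed

end

text \<open>The iterate of the indicator is the probability of being in \<open>y\<close> after
  \<open>t\<close> steps. As \<open>t\<close> may depend on both states, periodic chains are
  included.\<close>

locale irreducible_kernel = finite_kernel +
  assumes irreducible: "x \<in> S \<Longrightarrow> y \<in> S \<Longrightarrow> \<exists>t. 0 < (avg_op S P ^^ t) (indicator {y}) x"
begin

text \<open>Minimum principle: let \<open>u\<close> attain its minimum m in x0. Pointwise
  \<open>u\<close> dominates m plus (u y - m) times the indicator of \<open>y\<close>; iterating
  \<open>K\<close> at x0 until \<open>y\<close> has positive probability gives m >= m + (u y - m) *
  probability, hence u y = m.\<close>

lemma superharmonic_constant:
  assumes "\<And>x. x \<in> S \<Longrightarrow> K u x \<le> u x"
  shows "\<exists>c. \<forall>x\<in>S. u x = c"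
proof -
  define m where "m = Min (u ` S)"
  have m: "m \<le> u x" if "x \<in> S" for x
    using that finite_S by (simp add: m_def)
  have "m \<in> u ` S" unfolding m_def using finite_S S_nonempty by (intro Min_in) auto
  then obtain x0 where x0: "x0 \<in> S" "u x0 = m" by auto
  have "u y = m" if y: "y \<in> S" for y
  proof -
    obtain t where t: "0 < (K ^^ t) (indicator {y}) x0"
      using irreducible[OF x0(1) y] by blast
    have "m + (u y - m) * (K ^^ t) (indicator {y}) x0
        = (K ^^ t) (\<lambda>z. m + (u y - m) * indicator {y} z) x0"
      by (simp add: K_funpow_affine x0)
    also have "\<dots> \<le> (K ^^ t) u x0"
      by (rule K_funpow_mono) (auto simp: m x0 split: split_indicator)
    also have "\<dots> \<le> m"
      using K_funpow_superharmonic[OF assms x0(1)] x0 by simp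
    finally have "u y - m \<le> 0"
      using t by (simp add: mult_le_0_iff)
    with m[OF y] show ?thesis by simp
  qed
  then show ?thesis by blast
qed

text \<open>
  The equation is solved for the chain killed on entering a fixed state \<open>z\<close>, where the solution is a
  convergent series; \<open>g\<close> is then chosen to satisfy the equation in \<open>z\<close> as well.
\<close>

lemma poisson_equation: "\<exists>g h. \<forall>x\<in>S. g + h x = r x + K h x"
proof -
  obtain z where z: "z \<in> S" using S_nonempty by blast
  \<comment> \<open>\<open>Q\<close> is the kernel killed in \<open>z\<close>, and
    \<open>m n x\<close> below is the probability that the chain from \<open>x\<close> avoids
    \<open>z\<close> at all times 0 to n.\<close>
  define Q where "Q h x = (if x = z then 0 else K h x)" for h x
  define m where "m n = (Q ^^ n) (\<lambda>x. if x = z then 0 else 1)" for n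
  have m_Suc: "m (Suc n) = Q (m n)" for n by (simp add: m_def)
  have m_z: "m n z = 0" for n by (cases n) (simp_all add: m_def Q_def)
  have Q_mono: "Q h x \<le> Q h' x" if "\<And>y. y \<in> S \<Longrightarrow> h y \<le> h' y" "x \<in> S" for h h' x
    using that by (simp add: Q_def K_mono)
  have m_nonneg: "0 \<le> m n x" if "x \<in> S" for n x
    using that
  proof (induction n arbitrary: x)
    case (Suc n)
    have "K (\<lambda>_. 0) x \<le> K (m n) x" using Suc by (intro K_mono) auto
    then show ?case by (simp add: m_Suc Q_def K_const Suc.prems)
  qed (simp add: m_def)
  have m_decr: "m (Suc n) x \<le> m n x" if "x \<in> S" for n x
    using that
  proof (induction n arbitrary: x)
    case 0
    have "K (m 0) x \<le> K (\<lambda>_. 1) x" by (rule K_mono[OF 0]) (simp add: m_def)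
    then show ?case using 0 by (simp add: m_Suc Q_def K_const) (simp add: m_def)
  next
    case (Suc n)
    then show ?case by (subst (1 2) m_Suc) (rule Q_mono)
  qed
  \<comment> \<open>Avoiding \<open>z\<close> up to time n is at most as likely as being elsewhere
    at time n; irreducibility makes the latter smaller than 1 for some n.\<close>
  have m_hit: "m n x \<le> 1 - (K ^^ n) (indicator {z}) x" if "x \<in> S" for n x
    using that
  proof (induction n arbitrary: x)
    case 0
    show ?case by (simp add: m_def)
  next
    case (Suc n)
    have "K (m n) x \<le> K (\<lambda>x. 1 - (K ^^ n) (indicator {z}) x) x"
      using Suc by (intro K_mono) auto
    moreover have "(K ^^ Suc n) (indicator {z}) x \<le> 1"
      using K_funpow_bound[of "indicator {z}" 1 x "Suc n"] Suc.prems by simp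
    ultimately show ?case
      by (auto simp: m_Suc Q_def K_diff K_const Suc.prems)
  qed
  have "\<forall>x\<in>S. \<exists>t. m t x < 1"
  proof
    fix x assume "x \<in> S"
    with irreducible[OF this z] m_hit[OF this] show "\<exists>t. m t x < 1"
      by (metis diff_gt_0_iff_gt diff_less_eq less_add_same_cancel1 order_le_less_trans)
  qed
  then obtain t where t: "\<And>x. x \<in> S \<Longrightarrow> m (t x) x < 1" by metis
  \<comment> \<open>Survival probabilities decrease in time and \<open>S\<close> is finite, so the
    latest of the individual times serves all states at once.\<close>
  define N where "N = Max (t ` S)"
  have mN: "m N x < 1" if "x \<in> S" for x
  proof -
    have "m N x \<le> m (t x) x"
      by (rule lift_Suc_antimono_le[of "\<lambda>n. m n x"]) (use m_decr that finite_S in \<open>auto simp: N_def\<close>)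
    with t[OF that] show ?thesis by simp
  qed
  define c where "c = Max (m N ` S)"
  have c1: "c < 1" unfolding c_def using mN finite_S S_nonempty by simp
  have cm: "m N x \<le> c" if "x \<in> S" for x using that finite_S by (simp add: c_def)
  have c0: "0 \<le> c" using cm[OF z] m_z by simp
  have Q_scale: "Q (\<lambda>y. d * h y) x = d * Q h x" for d h x
    by (simp add: Q_def K_scale)
  have contr: "m (N + j) x \<le> c * m j x" if "x \<in> S" for j x
    using that
  proof (induction j arbitrary: x)
    case 0
    show ?case using cm[OF 0] m_z by (auto simp: m_def)
  next
    case (Suc j)
    have "Q (m (N + j)) x \<le> Q (\<lambda>y. c * m j y) x" using Suc by (intro Q_mono) auto
    then show ?case by (simp add: m_Suc Q_scale)
  qed
  have m_le1: "m n x \<le> 1" if "x \<in> S" for n x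
  proof -
    have "m n x \<le> m 0 x" by (rule lift_Suc_antimono_le[of "\<lambda>n. m n x"]) (use m_decr that in auto)
    also have "\<dots> \<le> 1" by (simp add: m_def)
    finally show ?thesis .
  qed
  \<comment> \<open>By the contraction over blocks of length N, a partial sum s satisfies s <= N + c
    * s, which bounds it by N / (1 - c).\<close>
  have summ: "summable (\<lambda>n. m n x)" if x: "x \<in> S" for x
  proof (rule summableI_nonneg_bounded[where x = "real N / (1 - c)"])
    show "0 \<le> m n x" for n by (rule m_nonneg[OF x])
    fix n
    have "(\<Sum>i<n. m i x) \<le> (\<Sum>i<N + n. m i x)"
      by (rule sum_mono2) (auto simp: m_nonneg x)
    also have "\<dots> = (\<Sum>i<N. m i x) + (\<Sum>j<n. m (N + j) x)"
      by (induction n) auto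
    also have "\<dots> \<le> (\<Sum>i<N. 1) + (\<Sum>j<n. c * m j x)"
      by (intro add_mono sum_mono contr[OF x] m_le1[OF x])
    finally have "(\<Sum>i<n. m i x) \<le> real N + c * (\<Sum>i<n. m i x)"
      by (simp add: sum_distrib_left)
    then show "(\<Sum>i<n. m i x) \<le> real N / (1 - c)"
      using c1 by (simp add: field_simps)
  qed
  \<comment> \<open>The solution \<open>u\<close> is the expected total of \<open>r\<close>
    collected before the first visit to \<open>z\<close>. The series is dominated by a multiple of
    the summable survival probabilities; the clause on signs serves the case r = 1 below.\<close>
  have sol: "\<exists>u. u z = 0 \<and> (\<forall>x\<in>S. x \<noteq> z \<longrightarrow> u x = r x + K u x) \<and> ((\<forall>x\<in>S. 0 \<le> r x) \<longrightarrow> (\<forall>x\<in>S. 0 \<le> u x))" for r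
  proof -
    define v where "v n = (Q ^^ n) (\<lambda>x. if x = z then 0 else r x)" for n
    obtain B where B: "0 \<le> B" "\<And>x. x \<in> S \<Longrightarrow> \<bar>r x\<bar> \<le> B" using bounded_on_S[of r] by blast
    have v_Suc: "v (Suc n) = Q (v n)" for n by (simp add: v_def)
    have v_z: "v n z = 0" for n by (cases n) (simp_all add: v_def Q_def)
    have bd: "v n x \<le> B * m n x \<and> - (B * m n x) \<le> v n x" if "x \<in> S" for n x
      using that
    proof (induction n arbitrary: x)
      case 0
      then show ?case using B(2)[OF 0] by (auto simp: v_def m_def)
    next
      case (Suc n)
      have "Q (v n) x \<le> Q (\<lambda>y. B * m n y) x" "Q (\<lambda>y. - B * m n y) x \<le> Q (v n) x"
        using Suc by (auto intro!: Q_mono)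
      then show ?case unfolding Q_scale by (simp add: m_Suc v_Suc)
    qed
    have sv: "summable (\<lambda>n. v n x)" if "x \<in> S" for x
      by (rule summable_comparison_test'[where g = "\<lambda>n. B * m n x" and N = 0])
         (use bd[OF that] summ[OF that] in \<open>auto intro!: summable_mult abs_leI simp: abs_le_iff minus_le_iff\<close>)
    define u where "u x = (\<Sum>n. v n x)" for x
    have "u x = r x + K u x" if "x \<in> S" "x \<noteq> z" for x
    proof -
      have "K u x = (\<Sum>y\<in>S. \<Sum>n. P x y * v n y)"
        unfolding avg_op_def u_def by (intro sum.cong refl suminf_mult[symmetric] sv)
      also have "\<dots> = (\<Sum>n. K (v n) x)"
        unfolding avg_op_def by (intro suminf_sum[symmetric] summable_mult sv)
      also have "\<dots> = (\<Sum>n. v (Suc n) x)"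
        using that by (simp add: v_Suc Q_def)
      also have "\<dots> = u x - v 0 x"
        unfolding u_def by (rule suminf_split_head[OF sv[OF that(1)]])
      finally show ?thesis using that by (simp add: v_def)
    qed
    moreover have "u z = 0" by (simp add: u_def v_z)
    moreover have "0 \<le> u x" if r: "\<forall>x\<in>S. 0 \<le> r x" and x: "x \<in> S" for x
    proof -
      have "0 \<le> v n x" if "x \<in> S" for n x
        using that
      proof (induction n arbitrary: x)
        case (Suc n)
        have "K (\<lambda>_. 0) x \<le> K (v n) x" using Suc by (intro K_mono) auto
        then show ?case by (simp add: v_Suc Q_def K_const Suc.prems)
      qed (use r in \<open>simp add: v_def\<close>)
      then show ?thesis unfolding u_def by (intro suminf_nonneg sv) (use x in auto)
    qed
    ultimately show ?thesis by blast
  qed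
  obtain u where u: "u z = 0" "\<And>x. x \<in> S \<Longrightarrow> x \<noteq> z \<Longrightarrow> u x = r x + K u x" using sol[of r] by blast
  \<comment> \<open>\<open>w\<close> is the expected hitting time of \<open>z\<close>, so 1 + K w z
    is the expected return time to \<open>z\<close>.\<close>
  obtain w where w: "w z = 0" "\<And>x. x \<in> S \<Longrightarrow> x \<noteq> z \<Longrightarrow> w x = 1 + K w x" "\<And>x. x \<in> S \<Longrightarrow> 0 \<le> w x"
    using sol[of "\<lambda>_. 1"] by auto
  have "K (\<lambda>_. 0) z \<le> K w z" by (rule K_mono[OF z w(3)])
  then have Kw: "1 + K w z > 0" by (simp add: K_const z)
  \<comment> \<open>Renewal reward formula: the expected reward over one return cycle divided by the
    expected length of the cycle. Since u - g * w vanishes in \<open>z\<close>, this is exactly the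
    equation at \<open>z\<close>.\<close>
  define g where "g = (r z + K u z) / (1 + K w z)"
  have "g + (u x - g * w x) = r x + K (\<lambda>x. u x - g * w x) x" if "x \<in> S" for x
  proof (cases "x = z")
    case True
    have "g * (1 + K w z) = r z + K u z" using Kw by (simp add: g_def)
    then show ?thesis using True by (simp add: u w K_diff K_scale algebra_simps)
  next
    case False
    then show ?thesis using u(2)[OF that] w(2)[OF that] by (simp add: K_diff K_scale algebra_simps)
  qed
  then show ?thesis by (intro exI[of _ g] exI[of _ "\<lambda>x. u x - g * w x"]) blast
qed

end

section \<open>The law of a controlled process\<close>

lemma integral_bind_prob:
  fixes f :: "'b \<Rightarrow> real"
  assumes M: "prob_space M" and N: "N \<in> M \<rightarrow>\<^sub>M prob_algebra K"
    and f: "f \<in> borel_measurable K" "\<And>x. x \<in> space K \<Longrightarrow> \<bar>f x\<bar> \<le> B"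
  shows "integral\<^sup>L (M \<bind> N) f = (\<integral>x. integral\<^sup>L (N x) f \<partial>M)"
proof (rule integral_bind[where B' = 1, OF f measurable_prob_algebraD[OF N]])
  show "finite_measure M" using M by (rule prob_space.finite_measure)
  show "AE x in M. emeasure (N x) (space (N x)) \<le> ennreal 1"
  proof (rule AE_I2)
    fix x assume "x \<in> space M"
    then have "prob_space (N x)" using measurable_space[OF N] by (auto simp: space_prob_algebra)
    then show "emeasure (N x) (space (N x)) \<le> ennreal 1" by (simp add: prob_space.emeasure_space_1)
  qed
qed

lemma step_space_measurable:
  fixes W :: "'s \<Rightarrow> 'a \<Rightarrow> real"
  assumes "finite (states \<phi>)" "finite (actions \<phi>)"
  shows "(\<lambda>s. W (fst s) (fst (snd s))) \<in> borel_measurable (step_space \<phi>)"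
proof -
  have *: "(\<lambda>s. (fst s, fst (snd s))) \<in> step_space \<phi> \<rightarrow>\<^sub>M count_space (states \<phi>) \<Otimes>\<^sub>M count_space (actions \<phi>)"
    by measurable
  have "case_prod W \<in> borel_measurable (count_space (states \<phi>) \<Otimes>\<^sub>M count_space (actions \<phi>))"
    using assms by (simp add: pair_measure_count_space)
  from measurable_compose[OF * this] show ?thesis by simp
qed

locale proper_mdp =
  fixes \<phi> :: "('s, 'a) mdp"
  assumes wf: "wf_mdp \<phi>"
begin

lemma finite_states: "finite (states \<phi>)" and states_nonempty: "states \<phi> \<noteq> {}"
  and finite_actions: "finite (actions \<phi>)" and actions_nonempty: "actions \<phi> \<noteq> {}"
  and sets_base: "sets (base \<phi>) = sets (restrict_space borel {0..1})"
  using wf by (auto simp: wf_mdp_def)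

lemma space_base: "space (base \<phi>) = {0..1}"
  using sets_eq_imp_space_eq[OF sets_base] by (simp add: space_restrict_space)

lemma tpmf_subset: "x \<in> states \<phi> \<Longrightarrow> a \<in> actions \<phi> \<Longrightarrow> set_pmf (tpmf \<phi> x a) \<subseteq> states \<phi>"
  and rdens_measurable: "x \<in> states \<phi> \<Longrightarrow> a \<in> actions \<phi> \<Longrightarrow> rdens \<phi> x a \<in> borel_measurable (base \<phi>)"
  and rdens_nonneg: "x \<in> states \<phi> \<Longrightarrow> a \<in> actions \<phi> \<Longrightarrow> r \<in> space (base \<phi>) \<Longrightarrow> 0 \<le> rdens \<phi> x a r"
  and prob_space_rdistr: "x \<in> states \<phi> \<Longrightarrow> a \<in> actions \<phi> \<Longrightarrow> prob_space (rdistr \<phi> x a)"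
  using wf by (auto simp: wf_mdp_def)

lemma sum_tpmf: "x \<in> states \<phi> \<Longrightarrow> a \<in> actions \<phi> \<Longrightarrow> (\<Sum>y\<in>states \<phi>. pmf (tpmf \<phi> x a) y) = 1"
  using tpmf_subset finite_states by (intro sum_pmf_eq_1) auto

lemma sets_rdistr: "sets (rdistr \<phi> x a) = sets (restrict_space borel {0..1})"
  by (simp add: rdistr_def sets_base)

lemma space_rdistr: "space (rdistr \<phi> x a) = {0..1}"
  by (simp add: rdistr_def space_base)

lemma id_measurable_base: "(\<lambda>r. r :: real) \<in> borel_measurable (base \<phi>)"
  unfolding measurable_cong_sets[OF sets_base refl] by (rule measurable_restrict_space1) simp

lemma integral_rdistr:
  assumes "x \<in> states \<phi>" "a \<in> actions \<phi>" "f \<in> borel_measurable (base \<phi>)"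
  shows "(\<integral>r. f r \<partial>rdistr \<phi> x a) = (\<integral>r. rdens \<phi> x a r * f r \<partial>base \<phi>)"
  unfolding rdistr_def
  by (subst integral_density) (use assms rdens_measurable rdens_nonneg in auto)

lemma mean_reward_eq:
  assumes "x \<in> states \<phi>" "a \<in> actions \<phi>"
  shows "mean_reward \<phi> x a = (\<integral>r. r \<partial>rdistr \<phi> x a)"
  unfolding integral_rdistr[OF assms id_measurable_base] mean_reward_def by (simp add: mult.commute)

lemma integrable_rdistr_id:
  assumes "x \<in> states \<phi>" "a \<in> actions \<phi>"
  shows "integrable (rdistr \<phi> x a) (\<lambda>r. r)"
proof -
  interpret prob_space "rdistr \<phi> x a" by (rule prob_space_rdistr[OF assms])
  show ?thesis
    by (rule integrable_const_bound[where B = 1])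
       (auto simp: space_rdistr measurable_cong_sets[OF sets_rdistr refl]
         intro!: AE_I2 measurable_restrict_space1)
qed

lemma mean_reward_bounds:
  assumes "x \<in> states \<phi>" "a \<in> actions \<phi>"
  shows "0 \<le> mean_reward \<phi> x a" "mean_reward \<phi> x a \<le> 1"
proof -
  interpret prob_space "rdistr \<phi> x a" by (rule prob_space_rdistr[OF assms])
  show "0 \<le> mean_reward \<phi> x a"
    unfolding mean_reward_eq[OF assms] by (rule integral_nonneg_AE) (auto simp: space_rdistr intro!: AE_I2)
  have "(\<integral>r. r \<partial>rdistr \<phi> x a) \<le> (\<integral>r. 1 \<partial>rdistr \<phi> x a)"
    by (rule integral_mono_AE[OF integrable_rdistr_id[OF assms]]) (auto simp: space_rdistr intro!: AE_I2)
  then show "mean_reward \<phi> x a \<le> 1" by (simp add: mean_reward_eq[OF assms] prob_space)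
qed

end

section \<open>Expectations along the trajectory of an arbitrary policy\<close>

locale controlled_mdp = proper_mdp +
  fixes \<pi> :: "('a, 'b) policy" and x
  assumes \<pi>: "\<pi> \<in> policies \<phi>" and x: "x \<in> states \<phi>"
begin

sublocale IT: Ionescu_Tulcea "step \<phi> \<pi> x" "\<lambda>_. step_space \<phi>"
  by (rule Ionescu_Tulcea_step[OF wf \<pi> x])

sublocale prob_space "trajectory \<phi> \<pi> x"
  by (rule prob_space_trajectory[OF wf \<pi> x])

abbreviation "Tr \<equiv> trajectory \<phi> \<pi> x"

text \<open>The law of the steps 0 to n - 1. The only history of length 0 is the function that is
  \<open>undefined\<close> everywhere.\<close>

definition hist :: "nat \<Rightarrow> (nat \<Rightarrow> 'a \<times> 'b \<times> real) measure" where
  "hist n = IT.C 0 n (\<lambda>_. undefined)"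

lemma sets_trajectory: "sets Tr = sets (PiM UNIV (\<lambda>_. step_space \<phi>))"
  by (simp add: trajectory_def)

lemma space_trajectory: "space Tr = space (PiM UNIV (\<lambda>_. step_space \<phi>))"
  by (simp add: trajectory_def)

lemma sets_hist: "sets (hist n) = sets (hist_space \<phi> n)"
  unfolding hist_def by (subst IT.sets_C) (auto simp: space_PiM)

lemma space_hist: "space (hist n) = space (hist_space \<phi> n)"
  using sets_eq_imp_space_eq[OF sets_hist] .

lemma prob_space_hist: "prob_space (hist n)"
  unfolding hist_def by (rule IT.prob_space_C) (auto simp: space_PiM)

lemma restrict_measurable: "(\<lambda>\<omega>. restrict \<omega> {0..<n}) \<in> Tr \<rightarrow>\<^sub>M hist_space \<phi> n"
  unfolding measurable_cong_sets[OF sets_trajectory refl]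
  by (rule measurable_restrict_subset) auto

text \<open>Identifies the finite-dimensional marginals of the limit measure with the recursively
  built laws, so that integrals over whole trajectories can be unrolled one step at a time.\<close>

lemma hist_eq: "hist n = distr Tr (hist_space \<phi> n) (\<lambda>\<omega>. restrict \<omega> {0..<n})"
proof (rule measure_eqI)
  fix Z assume "Z \<in> sets (hist n)"
  then have Z: "Z \<in> sets (hist_space \<phi> n)" by (simp add: sets_hist)
  have "emeasure (distr Tr (hist_space \<phi> n) (\<lambda>\<omega>. restrict \<omega> {0..<n})) Z
      = emeasure Tr (prod_emb UNIV (\<lambda>_. step_space \<phi>) {0..<n} Z)"
    by (rule emeasure_distr_restrict) (auto simp: sets_trajectory Z)
  also have "\<dots> = emeasure (hist n) (prod_emb {0..<n} (\<lambda>_. step_space \<phi>) {0..<n} Z)"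
    unfolding hist_def by (rule emeasure_trajectory[OF wf \<pi> x subset_refl Z])
  also have "prod_emb {0..<n} (\<lambda>_. step_space \<phi>) {0..<n} Z = Z"
    using sets.sets_into_space[OF Z] by (intro prod_emb_id) (simp add: space_PiM)
  finally show "emeasure (hist n) Z = emeasure (distr Tr (hist_space \<phi> n) (\<lambda>\<omega>. restrict \<omega> {0..<n})) Z" ..
qed (simp add: sets_hist)

lemma integral_hist:
  fixes G :: "_ \<Rightarrow> real"
  assumes "G \<in> borel_measurable (hist_space \<phi> n)"
  shows "(\<integral>h. G h \<partial>hist n) = (\<integral>\<omega>. G (restrict \<omega> {0..<n}) \<partial>Tr)"
  unfolding hist_eq by (rule integral_distr[OF restrict_measurable assms])

lemma hist_Suc: "hist (Suc n) = hist n \<bind> IT.eP n"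
  by (simp add: hist_def)

text \<open>The law of t + 1 steps is that of t steps followed by \<open>IT.eP t\<close>, which only
  appends a step drawn from \<open>step\<close> to the history; integrating the last coordinate is
  thus integrating against \<open>step\<close>.\<close>

lemma integral_coord:
  fixes F :: "_ \<Rightarrow> real"
  assumes F: "F \<in> borel_measurable (step_space \<phi>)" "\<And>s. s \<in> space (step_space \<phi>) \<Longrightarrow> \<bar>F s\<bar> \<le> B"
  shows "(\<integral>\<omega>. F (\<omega> t) \<partial>Tr) = (\<integral>h. (\<integral>s. F s \<partial>step \<phi> \<pi> x t h) \<partial>hist t)"
proof -
  have F': "(\<lambda>h. F (h t)) \<in> borel_measurable (hist_space \<phi> (Suc t))"
    by (rule measurable_compose[OF _ F(1)]) (rule measurable_component_singleton, simp)
  have eP: "IT.eP t \<in> hist t \<rightarrow>\<^sub>M prob_algebra (hist_space \<phi> (Suc t))"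
  proof (rule measurable_prob_algebraI)
    show "IT.eP t \<in> hist t \<rightarrow>\<^sub>M subprob_algebra (hist_space \<phi> (Suc t))"
      using IT.measurable_eP[of t] by (simp add: measurable_cong_sets[OF sets_hist refl])
    show "prob_space (IT.eP t h)" if "h \<in> space (hist t)" for h
      using that by (intro IT.prob_space_eP) (simp add: space_hist)
  qed
  have "(\<integral>\<omega>. F (\<omega> t) \<partial>Tr) = (\<integral>h. F (h t) \<partial>hist (Suc t))"
    by (subst integral_hist[OF F']) simp
  also have "\<dots> = (\<integral>h. (\<integral>h'. F (h' t) \<partial>IT.eP t h) \<partial>hist t)"
    unfolding hist_Suc
    by (rule integral_bind_prob[OF prob_space_hist eP F'])
       (auto intro!: F(2) simp: space_PiM)
  also have "\<dots> = (\<integral>h. (\<integral>s. F s \<partial>step \<phi> \<pi> x t h) \<partial>hist t)"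
  proof (rule Bochner_Integration.integral_cong[OF refl])
    fix h assume "h \<in> space (hist t)"
    then have h: "h \<in> space (hist_space \<phi> t)" by (simp add: space_hist)
    have "(\<lambda>s. h(t := s)) \<in> step \<phi> \<pi> x t h \<rightarrow>\<^sub>M hist_space \<phi> (Suc t)"
      unfolding measurable_cong_sets[OF IT.sets_P[OF h] refl]
      using h by (intro measurable_fun_upd[where J = "{0..<t}"]) auto
    from integral_distr[OF this F'] show "(\<integral>h'. F (h' t) \<partial>IT.eP t h) = (\<integral>s. F s \<partial>step \<phi> \<pi> x t h)"
      by (simp add: IT.eP_def)
  qed
  finally show ?thesis .
qed

lemma next_state_prob_algebra:
  assumes "h \<in> space (hist_space \<phi> t)"
  shows "next_state \<phi> x t h \<in> space (prob_algebra (count_space (states \<phi>)))"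
proof (cases t)
  case 0
  then show ?thesis using x by (auto simp: next_state_def space_prob_algebra intro!: prob_space_return)
next
  case (Suc m)
  from assms have "h m \<in> space (step_space \<phi>)" by (auto simp: Suc space_PiM)
  then have h: "fst (h m) \<in> states \<phi>" "fst (snd (h m)) \<in> actions \<phi>"
    by (auto simp: space_pair_measure)
  have "measure_pmf.prob (tpmf \<phi> (fst (h m)) (fst (snd (h m)))) (states \<phi>) = 1"
    using tpmf_subset[OF h] by (subst measure_pmf.prob_eq_1) (auto simp: AE_measure_pmf_iff)
  then show ?thesis
    by (auto simp: Suc next_state_def space_prob_algebra sets_restrict_space measure_pmf.emeasure_eq_measure
        intro!: prob_space_restrict_space)
qed

lemma policy_prob_algebra:
  assumes "h \<in> space (hist_space \<phi> t)" "y \<in> states \<phi>"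
  shows "\<pi> t h y \<in> space (prob_algebra (count_space (actions \<phi>)))"
proof -
  have "case_prod (\<pi> t) \<in> hist_space \<phi> t \<Otimes>\<^sub>M count_space (states \<phi>) \<rightarrow>\<^sub>M prob_algebra (count_space (actions \<phi>))"
    using \<pi> by (simp add: policies_def)
  from measurable_space[OF this, of "(h, y)"] assms show ?thesis by (simp add: space_pair_measure)
qed

lemma integral_step:
  fixes F :: "_ \<Rightarrow> real"
  assumes h: "h \<in> space (hist_space \<phi> t)"
    and F: "F \<in> borel_measurable (step_space \<phi>)" "\<And>s. s \<in> space (step_space \<phi>) \<Longrightarrow> \<bar>F s\<bar> \<le> B"
  shows "(\<integral>s. F s \<partial>step \<phi> \<pi> x t h)
    = (\<integral>y. (\<integral>a. (\<integral>r. F (y, a, r) \<partial>rdistr \<phi> y a) \<partial>\<pi> t h y) \<partial>next_state \<phi> x t h)"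
proof -
  let ?N = "next_state \<phi> x t h"
  have N: "prob_space ?N" "sets ?N = sets (count_space (states \<phi>))"
    using next_state_prob_algebra[OF h] by (auto simp: space_prob_algebra)
  have pi: "prob_space (\<pi> t h y)" "sets (\<pi> t h y) = sets (count_space (actions \<phi>))" if "y \<in> states \<phi>" for y
    using policy_prob_algebra[OF h that] by (auto simp: space_prob_algebra)
  have ret: "(\<lambda>r. return (step_space \<phi>) (y, a, r)) \<in> rdistr \<phi> y a \<rightarrow>\<^sub>M prob_algebra (step_space \<phi>)"
    if "y \<in> states \<phi>" "a \<in> actions \<phi>" for y a
    unfolding measurable_cong_sets[OF sets_rdistr refl]
    by (rule measurable_compose[OF _ measurable_return_prob_space], intro measurable_Pair measurable_const)
       (use that in \<open>auto intro: measurable_ident_sets\<close>)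
  \<comment> \<open>The measurability rule for binds speaks of families of measures; a one-point
    parameter space turns it into a statement about a single bind.\<close>
  have bind_in: "M \<bind> k \<in> space (prob_algebra (step_space \<phi>))"
    if "k \<in> M \<rightarrow>\<^sub>M prob_algebra (step_space \<phi>)" "prob_space M" for M :: "'c measure" and k
    using that measurable_bind_prob_space[of "\<lambda>_. M" "count_space {()}" M k "step_space \<phi>"]
    by (auto simp: space_prob_algebra)
  have rd: "(\<lambda>a. rdistr \<phi> y a \<bind> (\<lambda>r. return (step_space \<phi>) (y, a, r))) \<in> \<pi> t h y \<rightarrow>\<^sub>M prob_algebra (step_space \<phi>)"
    if "y \<in> states \<phi>" for y
    unfolding measurable_cong_sets[OF pi(2)[OF that] refl]
    by (auto intro!: bind_in ret prob_space_rdistr that)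
  have pd: "(\<lambda>y. \<pi> t h y \<bind> (\<lambda>a. rdistr \<phi> y a \<bind> (\<lambda>r. return (step_space \<phi>) (y, a, r))))
      \<in> ?N \<rightarrow>\<^sub>M prob_algebra (step_space \<phi>)"
    unfolding measurable_cong_sets[OF N(2) refl]
    by (auto intro!: bind_in rd pi)
  have "(\<integral>s. F s \<partial>step \<phi> \<pi> x t h) = (\<integral>y. integral\<^sup>L (\<pi> t h y \<bind> (\<lambda>a. rdistr \<phi> y a \<bind>
      (\<lambda>r. return (step_space \<phi>) (y, a, r)))) F \<partial>?N)"
    unfolding step_def by (rule integral_bind_prob[OF N(1) pd F])
  also have "\<dots> = (\<integral>y. (\<integral>a. (\<integral>r. F (y, a, r) \<partial>rdistr \<phi> y a) \<partial>\<pi> t h y) \<partial>?N)"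
  proof (rule Bochner_Integration.integral_cong[OF refl])
    fix y assume "y \<in> space ?N"
    then have y: "y \<in> states \<phi>" using sets_eq_imp_space_eq[OF N(2)] by simp
    have "integral\<^sup>L (\<pi> t h y \<bind> (\<lambda>a. rdistr \<phi> y a \<bind> (\<lambda>r. return (step_space \<phi>) (y, a, r)))) F
      = (\<integral>a. integral\<^sup>L (rdistr \<phi> y a \<bind> (\<lambda>r. return (step_space \<phi>) (y, a, r))) F \<partial>\<pi> t h y)"
      by (rule integral_bind_prob[OF pi(1)[OF y] rd[OF y] F])
    also have "\<dots> = (\<integral>a. (\<integral>r. F (y, a, r) \<partial>rdistr \<phi> y a) \<partial>\<pi> t h y)"
    proof (rule Bochner_Integration.integral_cong[OF refl])
      fix a assume "a \<in> space (\<pi> t h y)"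
      then have a: "a \<in> actions \<phi>" using sets_eq_imp_space_eq[OF pi(2)[OF y]] by simp
      have "integral\<^sup>L (rdistr \<phi> y a \<bind> (\<lambda>r. return (step_space \<phi>) (y, a, r))) F
        = (\<integral>r. integral\<^sup>L (return (step_space \<phi>) (y, a, r)) F \<partial>rdistr \<phi> y a)"
        by (rule integral_bind_prob[OF prob_space_rdistr[OF y a] ret[OF y a] F])
      also have "\<dots> = (\<integral>r. F (y, a, r) \<partial>rdistr \<phi> y a)"
        by (intro Bochner_Integration.integral_cong refl integral_return F)
           (auto simp: space_pair_measure space_rdistr space_restrict_space y a)
      finally show "integral\<^sup>L (rdistr \<phi> y a \<bind> (\<lambda>r. return (step_space \<phi>) (y, a, r))) F
        = (\<integral>r. F (y, a, r) \<partial>rdistr \<phi> y a)" .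
    qed
    finally show "integral\<^sup>L (\<pi> t h y \<bind> (\<lambda>a. rdistr \<phi> y a \<bind> (\<lambda>r. return (step_space \<phi>) (y, a, r)))) F
      = (\<integral>a. (\<integral>r. F (y, a, r) \<partial>rdistr \<phi> y a) \<partial>\<pi> t h y)" .
  qed
  finally show ?thesis .
qed

end

context proper_mdp
begin

lemma finite_bound: "\<exists>B. \<forall>y\<in>states \<phi>. \<forall>a\<in>actions \<phi>. \<bar>W y a :: real\<bar> \<le> B"
proof -
  have "\<bar>W y a\<bar> \<le> (\<Sum>(y, a)\<in>states \<phi> \<times> actions \<phi>. \<bar>W y a\<bar>)" if "y \<in> states \<phi>" "a \<in> actions \<phi>" for y a
    using that finite_states finite_actions
    by (intro member_le_sum[of "(y, a)" _ "\<lambda>(y, a). \<bar>W y a\<bar>", simplified]) auto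
  then show ?thesis by blast
qed

end

context controlled_mdp
begin

lemma trajectory_coord:
  assumes "\<omega> \<in> space Tr"
  shows "fst (\<omega> t) \<in> states \<phi>" "fst (snd (\<omega> t)) \<in> actions \<phi>" "snd (snd (\<omega> t)) \<in> {0..1}"
proof -
  have "\<omega> t \<in> space (step_space \<phi>)" using assms by (auto simp: space_trajectory space_PiM)
  then show "fst (\<omega> t) \<in> states \<phi>" "fst (snd (\<omega> t)) \<in> actions \<phi>" "snd (snd (\<omega> t)) \<in> {0..1}"
    by (auto simp: space_pair_measure space_restrict_space)
qed

lemma coord_measurable: "(\<lambda>\<omega>. \<omega> t) \<in> Tr \<rightarrow>\<^sub>M step_space \<phi>"
  unfolding measurable_cong_sets[OF sets_trajectory refl] by (rule measurable_component_singleton) simp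

lemma reward_measurable: "(\<lambda>s. snd (snd s)) \<in> borel_measurable (step_space \<phi>)"
proof -
  have "(\<lambda>r. r) \<in> restrict_space borel {0..1} \<rightarrow>\<^sub>M borel" by (rule measurable_restrict_space1) simp
  moreover have "(\<lambda>s. snd (snd s)) \<in> step_space \<phi> \<rightarrow>\<^sub>M restrict_space borel {0..1}" by measurable
  ultimately show ?thesis by (rule measurable_compose[rotated])
qed

lemma reward_bounded: "s \<in> space (step_space \<phi>) \<Longrightarrow> \<bar>snd (snd s)\<bar> \<le> 1"
  by (auto simp: space_pair_measure space_restrict_space)

lemma state_action_integrable:
  fixes W :: "'a \<Rightarrow> 'b \<Rightarrow> real"
  shows "integrable Tr (\<lambda>\<omega>. W (state_at t \<omega>) (fst (snd (\<omega> t))))"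
proof -
  obtain B where "\<And>y a. y \<in> states \<phi> \<Longrightarrow> a \<in> actions \<phi> \<Longrightarrow> \<bar>W y a\<bar> \<le> B" using finite_bound by metis
  moreover have "(\<lambda>\<omega>. W (state_at t \<omega>) (fst (snd (\<omega> t)))) \<in> borel_measurable Tr"
    using measurable_compose[OF coord_measurable step_space_measurable[OF finite_states finite_actions]]
    by (simp add: state_at_def)
  ultimately show ?thesis
    by (intro integrable_const_bound[where B = B]) (auto simp: trajectory_coord state_at_def intro!: AE_I2)
qed

lemma state_integrable: "integrable Tr (\<lambda>\<omega>. k (state_at t \<omega>) :: real)"
  by (rule state_action_integrable)

lemma reward_integrable: "integrable Tr (reward_at t)"
  using measurable_compose[OF coord_measurable reward_measurable]
  by (intro integrable_const_bound[where B = 1])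
     (use trajectory_coord(3)[of _ t] in \<open>auto simp: reward_at_def[abs_def] intro!: AE_I2\<close>)

lemma state_action_integral:
  fixes W :: "'a \<Rightarrow> 'b \<Rightarrow> real"
  shows "(\<integral>\<omega>. W (state_at t \<omega>) (fst (snd (\<omega> t))) \<partial>Tr)
    = (\<integral>h. (\<integral>y. (\<integral>a. W y a \<partial>\<pi> t h y) \<partial>next_state \<phi> x t h) \<partial>hist t)"
proof -
  obtain B where B: "\<And>y a. y \<in> states \<phi> \<Longrightarrow> a \<in> actions \<phi> \<Longrightarrow> \<bar>W y a\<bar> \<le> B" using finite_bound by metis
  let ?F = "\<lambda>s. W (fst s) (fst (snd s))"
  have F: "?F \<in> borel_measurable (step_space \<phi>)"
    by (rule step_space_measurable[OF finite_states finite_actions])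
  have FB: "\<bar>?F s\<bar> \<le> B" if "s \<in> space (step_space \<phi>)" for s
    using that by (auto simp: space_pair_measure B)
  have "(\<integral>\<omega>. ?F (\<omega> t) \<partial>Tr) = (\<integral>h. (\<integral>s. ?F s \<partial>step \<phi> \<pi> x t h) \<partial>hist t)"
    by (rule integral_coord[OF F FB])
  also have "\<dots> = (\<integral>h. (\<integral>y. (\<integral>a. W y a \<partial>\<pi> t h y) \<partial>next_state \<phi> x t h) \<partial>hist t)"
  proof (rule Bochner_Integration.integral_cong[OF refl])
    fix h assume "h \<in> space (hist t)"
    then have h: "h \<in> space (hist_space \<phi> t)" by (simp add: space_hist)
    have N: "space (next_state \<phi> x t h) = states \<phi>"
      using sets_eq_imp_space_eq[of _ "count_space (states \<phi>)"] next_state_prob_algebra[OF h]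
      by (auto simp: space_prob_algebra)
    have P: "space (\<pi> t h y) = actions \<phi>" if "y \<in> states \<phi>" for y
      using sets_eq_imp_space_eq[of _ "count_space (actions \<phi>)"] policy_prob_algebra[OF h that]
      by (auto simp: space_prob_algebra)
    show "(\<integral>s. ?F s \<partial>step \<phi> \<pi> x t h) = (\<integral>y. (\<integral>a. W y a \<partial>\<pi> t h y) \<partial>next_state \<phi> x t h)"
      by (rule trans[OF integral_step[OF h F FB]], assumption, intro Bochner_Integration.integral_cong refl)
         (simp add: N P prob_space.prob_space[OF prob_space_rdistr])
  qed
  finally show ?thesis by (simp add: state_at_def)
qed

text \<open>Replaces the random rewards by functions of state and action, after which all integrands
  range over a finite set and are bounded.\<close>

lemma reward_integral:
  "(\<integral>\<omega>. reward_at t \<omega> \<partial>Tr) = (\<integral>\<omega>. mean_reward \<phi> (state_at t \<omega>) (fst (snd (\<omega> t))) \<partial>Tr)"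
proof -
  have "(\<integral>\<omega>. snd (snd (\<omega> t)) \<partial>Tr) = (\<integral>h. (\<integral>s. snd (snd s) \<partial>step \<phi> \<pi> x t h) \<partial>hist t)"
    by (rule integral_coord[OF reward_measurable reward_bounded])
  also have "\<dots> = (\<integral>h. (\<integral>y. (\<integral>a. mean_reward \<phi> y a \<partial>\<pi> t h y) \<partial>next_state \<phi> x t h) \<partial>hist t)"
  proof (rule Bochner_Integration.integral_cong[OF refl])
    fix h assume "h \<in> space (hist t)"
    then have h: "h \<in> space (hist_space \<phi> t)" by (simp add: space_hist)
    have N: "space (next_state \<phi> x t h) = states \<phi>"
      using sets_eq_imp_space_eq[of _ "count_space (states \<phi>)"] next_state_prob_algebra[OF h]
      by (auto simp: space_prob_algebra)
    have P: "space (\<pi> t h y) = actions \<phi>" if "y \<in> states \<phi>" for y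
      using sets_eq_imp_space_eq[of _ "count_space (actions \<phi>)"] policy_prob_algebra[OF h that]
      by (auto simp: space_prob_algebra)
    show "(\<integral>s. snd (snd s) \<partial>step \<phi> \<pi> x t h)
        = (\<integral>y. (\<integral>a. mean_reward \<phi> y a \<partial>\<pi> t h y) \<partial>next_state \<phi> x t h)"
      by (rule trans[OF integral_step[OF h reward_measurable reward_bounded]], assumption,
          intro Bochner_Integration.integral_cong refl) (simp add: N P mean_reward_eq)
  qed
  finally show ?thesis by (simp add: reward_at_def state_action_integral)
qed

lemma state_integral:
  "(\<integral>\<omega>. k (state_at t \<omega>) \<partial>Tr) = (\<integral>h. (\<integral>y. k y \<partial>next_state \<phi> x t h) \<partial>hist t)" for k :: "'a \<Rightarrow> real"
proof -
  have "(\<integral>\<omega>. k (state_at t \<omega>) \<partial>Tr)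
      = (\<integral>h. (\<integral>y. (\<integral>a. k y \<partial>\<pi> t h y) \<partial>next_state \<phi> x t h) \<partial>hist t)"
    by (rule state_action_integral)
  also have "\<dots> = (\<integral>h. (\<integral>y. k y \<partial>next_state \<phi> x t h) \<partial>hist t)"
  proof (intro Bochner_Integration.integral_cong refl)
    fix h y assume "h \<in> space (hist t)" "y \<in> space (next_state \<phi> x t h)"
    then have h: "h \<in> space (hist_space \<phi> t)" and "y \<in> states \<phi>"
      using sets_eq_imp_space_eq[of _ "count_space (states \<phi>)"] next_state_prob_algebra[of h t]
      by (auto simp: space_prob_algebra space_hist)
    then have "prob_space (\<pi> t h y)" using policy_prob_algebra by (auto simp: space_prob_algebra)
    then show "(\<integral>a. k y \<partial>\<pi> t h y) = k y" by (simp add: prob_space.prob_space)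
  qed
  finally show ?thesis .
qed

lemma initial_state_integral: "(\<integral>\<omega>. k (state_at 0 \<omega>) \<partial>Tr) = (k x :: real)"
proof -
  have "(\<integral>y. k y \<partial>return (count_space (states \<phi>)) x) = k x"
    by (rule integral_return) (auto simp: x)
  then show ?thesis
    by (simp add: state_integral next_state_def prob_space.prob_space[OF prob_space_hist])
qed

text \<open>The Markov property: \<open>next_state\<close> at time Suc t reads only step
  \<open>t\<close> of the history, even when the policy reads all of it.\<close>

lemma next_state_integral:
  fixes k :: "'a \<Rightarrow> real"
  shows "(\<integral>\<omega>. k (state_at (Suc t) \<omega>) \<partial>Tr)
    = (\<integral>\<omega>. (\<Sum>y\<in>states \<phi>. pmf (tpmf \<phi> (state_at t \<omega>) (fst (snd (\<omega> t)))) y * k y) \<partial>Tr)"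
proof -
  let ?W = "\<lambda>z a. \<Sum>y\<in>states \<phi>. pmf (tpmf \<phi> z a) y * k y"
  have W: "(\<lambda>h. ?W (fst (h t)) (fst (snd (h t)))) \<in> borel_measurable (hist_space \<phi> (Suc t))"
    by (rule measurable_compose[OF _ step_space_measurable[OF finite_states finite_actions, of ?W]],
        rule measurable_component_singleton) simp
  have "(\<integral>\<omega>. k (state_at (Suc t) \<omega>) \<partial>Tr)
      = (\<integral>h. ?W (fst (h t)) (fst (snd (h t))) \<partial>hist (Suc t))"
    unfolding state_integral
  proof (rule Bochner_Integration.integral_cong[OF refl])
    fix h assume "h \<in> space (hist (Suc t))"
    then have "h t \<in> space (step_space \<phi>)" by (auto simp: space_hist space_PiM)
    then have h: "fst (h t) \<in> states \<phi>" "fst (snd (h t)) \<in> actions \<phi>"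
      by (auto simp: space_pair_measure)
    have "(\<integral>y. k y \<partial>next_state \<phi> x (Suc t) h)
        = (\<integral>y. indicator (states \<phi>) y * k y \<partial>measure_pmf (tpmf \<phi> (fst (h t)) (fst (snd (h t)))))"
      by (simp add: next_state_def integral_restrict_space)
    also have "\<dots> = (\<Sum>y\<in>states \<phi>. pmf (tpmf \<phi> (fst (h t)) (fst (snd (h t)))) y *\<^sub>R (indicator (states \<phi>) y * k y))"
      by (rule integral_measure_pmf[OF finite_states]) (use tpmf_subset[OF h] in auto)
    finally show "(\<integral>y. k y \<partial>next_state \<phi> x (Suc t) h) = ?W (fst (h t)) (fst (snd (h t)))"
      by simp
  qed
  also have "\<dots> = (\<integral>\<omega>. ?W (fst (\<omega> t)) (fst (snd (\<omega> t))) \<partial>Tr)"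
    by (subst integral_hist[OF W]) simp
  finally show ?thesis by (simp add: state_at_def)
qed

lemma total_reward_eq: "total_reward \<phi> \<pi> x T = (\<Sum>t<T. \<integral>\<omega>. reward_at t \<omega> \<partial>Tr)"
  unfolding total_reward_def by (rule Bochner_Integration.integral_sum) (rule reward_integrable)

lemma bellman_integral:
  "(\<integral>\<omega>. reward_at t \<omega> \<partial>Tr) + (\<integral>\<omega>. k (state_at (Suc t) \<omega>) \<partial>Tr)
    = (\<integral>\<omega>. bellman \<phi> (fst (snd (\<omega> t))) k (state_at t \<omega>) \<partial>Tr)"
  unfolding reward_integral next_state_integral bellman_def
  by (rule Bochner_Integration.integral_add[symmetric]) (rule state_action_integrable)+

text \<open>Under any policy the expectation of the accumulated reward plus \<open>k\<close> of the
  current state grows by at most \<open>g\<close> per step, because the inequality holds for every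
  action that might be taken.\<close>

lemma total_reward_le:
  assumes "\<And>y a. y \<in> states \<phi> \<Longrightarrow> a \<in> actions \<phi> \<Longrightarrow> bellman \<phi> a k y \<le> g + k y"
  shows "total_reward \<phi> \<pi> x T + (\<integral>\<omega>. k (state_at T \<omega>) \<partial>Tr) \<le> g * real T + k x"
proof (induction T)
  case 0
  then show ?case by (simp add: total_reward_eq initial_state_integral)
next
  case (Suc T)
  have "(\<integral>\<omega>. bellman \<phi> (fst (snd (\<omega> T))) k (state_at T \<omega>) \<partial>Tr) \<le> (\<integral>\<omega>. g + k (state_at T \<omega>) \<partial>Tr)"
    using assms
    by (intro integral_mono Bochner_Integration.integrable_add state_integrable integrable_const
          state_action_integrable[of "\<lambda>y a. bellman \<phi> a k y"])
       (auto simp: state_at_def trajectory_coord)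
  also have "\<dots> = g + (\<integral>\<omega>. k (state_at T \<omega>) \<partial>Tr)"
    by (simp add: state_integrable prob_space)
  finally show ?case
    using Suc bellman_integral[of T k] by (simp add: total_reward_eq algebra_simps)
qed

text \<open>\<open>k\<close> is bounded on the finite state set, so the boundary terms of
  \<open>total_reward_le\<close> vanish after division by \<open>T\<close>.\<close>

lemma liminf_average_reward_le:
  assumes "\<And>y a. y \<in> states \<phi> \<Longrightarrow> a \<in> actions \<phi> \<Longrightarrow> bellman \<phi> a k y \<le> g + k y"
  shows "liminf (\<lambda>T. ereal (total_reward \<phi> \<pi> x T / real T)) \<le> ereal g"
proof -
  obtain B where B: "\<And>y. y \<in> states \<phi> \<Longrightarrow> \<bar>k y\<bar> \<le> B"
    using finite_bound[of "\<lambda>y a. k y"] actions_nonempty by blast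
  have low: "- B \<le> (\<integral>\<omega>. k (state_at T \<omega>) \<partial>Tr)" for T
  proof -
    have "(\<integral>\<omega>. - B \<partial>Tr) \<le> (\<integral>\<omega>. k (state_at T \<omega>) \<partial>Tr)"
      using B by (intro integral_mono state_integrable integrable_const)
        (auto simp: state_at_def dest!: trajectory_coord(1)[of _ T] simp: abs_le_iff minus_le_iff)
    then show ?thesis by (simp add: prob_space)
  qed
  have up: "total_reward \<phi> \<pi> x T / real T \<le> g + 2 * B / real T" if "T \<ge> 1" for T
    using total_reward_le[OF assms, of T] low[of T] B[OF x] that by (simp add: field_simps abs_le_iff)
  have "(\<lambda>T. g + 2 * B / real T) \<longlonglongrightarrow> g + 0"
    by (intro tendsto_add tendsto_const lim_const_over_n)
  then have "(\<lambda>T. ereal (g + 2 * B / real T)) \<longlonglongrightarrow> ereal g" by simp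
  from lim_imp_Liminf[OF _ this] have "liminf (\<lambda>T. ereal (g + 2 * B / real T)) = ereal g" by simp
  moreover have "liminf (\<lambda>T. ereal (total_reward \<phi> \<pi> x T / real T)) \<le> liminf (\<lambda>T. ereal (g + 2 * B / real T))"
    by (rule Liminf_mono) (auto simp: up intro!: eventually_sequentiallyI[of 1])
  ultimately show ?thesis by simp
qed

end

context proper_mdp
begin

lemma opt_gain_le:
  assumes "x \<in> states \<phi>" "\<And>y a. y \<in> states \<phi> \<Longrightarrow> a \<in> actions \<phi> \<Longrightarrow> bellman \<phi> a k y \<le> g + k y"
  shows "opt_gain \<phi> x \<le> ereal g"
  unfolding opt_gain_def
proof (rule SUP_least)
  fix \<pi> assume "\<pi> \<in> policies \<phi>"
  then interpret controlled_mdp \<phi> \<pi> x by unfold_locales (auto simp: assms)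
  show "liminf (\<lambda>T. ereal (total_reward \<phi> \<pi> x T / real T)) \<le> ereal g"
    by (rule liminf_average_reward_le[OF assms(2)])
qed

end

section \<open>Stationary policies as Markov kernels, and verification of optimality\<close>

locale stationary_mdp = proper_mdp +
  fixes f :: "'a \<Rightarrow> 'b"
  assumes f: "f \<in> det_policies \<phi>"
begin

definition "ker y z = pmf (tpmf \<phi> y (f y)) z"

definition "rew y = mean_reward \<phi> y (f y)"

lemma f_actions: "y \<in> states \<phi> \<Longrightarrow> f y \<in> actions \<phi>"
  using f by (auto simp: det_policies_def)

sublocale finite_kernel "states \<phi>" ker
  by unfold_locales (auto simp: finite_states states_nonempty ker_def sum_tpmf f_actions)

lemma controlled: "x \<in> states \<phi> \<Longrightarrow> controlled_mdp \<phi> (stationary \<phi> f) x"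
  by unfold_locales (simp_all add: stationary_in_policies[OF wf f])

lemma bellman_eq: "bellman \<phi> (f y) k y = rew y + K k y"
  by (simp add: bellman_def rew_def avg_op_def ker_def)

lemma stationary_integral:
  fixes W :: "'a \<Rightarrow> 'b \<Rightarrow> real"
  assumes "x \<in> states \<phi>"
  shows "(\<integral>\<omega>. W (state_at t \<omega>) (fst (snd (\<omega> t))) \<partial>trajectory \<phi> (stationary \<phi> f) x)
    = (\<integral>\<omega>. W (state_at t \<omega>) (f (state_at t \<omega>)) \<partial>trajectory \<phi> (stationary \<phi> f) x)"
proof -
  interpret controlled_mdp \<phi> "stationary \<phi> f" x by (rule controlled[OF assms])
  show ?thesis
    unfolding state_action_integral[of W] state_integral[of "\<lambda>y. W y (f y)"]
  proof (intro Bochner_Integration.integral_cong refl)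
    fix h y assume "h \<in> space (hist t)" "y \<in> space (next_state \<phi> x t h)"
    then have "y \<in> states \<phi>"
      using sets_eq_imp_space_eq[of _ "count_space (states \<phi>)"] next_state_prob_algebra[of h t]
      by (auto simp: space_prob_algebra space_hist)
    then show "(\<integral>a. W y a \<partial>stationary \<phi> f t h y) = W y (f y)"
      unfolding stationary_def by (intro integral_return) (auto simp: f_actions)
  qed
qed

text \<open>Conditioning on the state before the last transition replaces \<open>k\<close> by
  \<open>K k\<close>, so the induction must keep \<open>k\<close> arbitrary.\<close>

lemma state_expectation:
  assumes "x \<in> states \<phi>"
  shows "(\<integral>\<omega>. k (state_at t \<omega>) \<partial>trajectory \<phi> (stationary \<phi> f) x) = (K ^^ t) k x"
proof -
  interpret controlled_mdp \<phi> "stationary \<phi> f" x by (rule controlled[OF assms])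
  show ?thesis
  proof (induction t arbitrary: k)
    case 0
    show ?case by (simp add: initial_state_integral)
  next
    case (Suc t)
    have "(\<integral>\<omega>. k (state_at (Suc t) \<omega>) \<partial>Tr) = (\<integral>\<omega>. K k (state_at t \<omega>) \<partial>Tr)"
      unfolding next_state_integral
      by (subst stationary_integral[OF assms]) (simp add: avg_op_def ker_def)
    then show ?case by (simp add: Suc funpow_swap1)
  qed
qed

lemma reward_expectation:
  assumes "x \<in> states \<phi>"
  shows "(\<integral>\<omega>. reward_at t \<omega> \<partial>trajectory \<phi> (stationary \<phi> f) x) = (K ^^ t) rew x"
proof -
  interpret controlled_mdp \<phi> "stationary \<phi> f" x by (rule controlled[OF assms])
  show ?thesis
    unfolding reward_integral stationary_integral[OF assms, of "mean_reward \<phi>"] state_expectation[OF assms, symmetric]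
    by (simp add: rew_def)
qed

lemma total_reward_stationary:
  assumes "x \<in> states \<phi>"
  shows "total_reward \<phi> (stationary \<phi> f) x T = (\<Sum>t<T. (K ^^ t) rew x)"
proof -
  interpret controlled_mdp \<phi> "stationary \<phi> f" x by (rule controlled[OF assms])
  show ?thesis by (simp add: total_reward_eq reward_expectation assms)
qed

lemma
  assumes "\<And>y. y \<in> states \<phi> \<Longrightarrow> bellman \<phi> (f y) k y = g + k y" and x: "x \<in> states \<phi>"
  shows average_reward_lim: "(\<lambda>T. total_reward \<phi> (stationary \<phi> f) x T / real T) \<longlonglongrightarrow> g"
    and gain_eq: "gain \<phi> f x = g"
proof -
  show *: "(\<lambda>T. total_reward \<phi> (stationary \<phi> f) x T / real T) \<longlonglongrightarrow> g"
    unfolding total_reward_stationary[OF x]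
    by (rule K_funpow_average[OF _ x, of g k]) (use assms(1) bellman_eq in auto)
  then show "gain \<phi> f x = g" unfolding gain_def by (rule limI)
qed

lemma gain_le_opt_gain:
  assumes "\<And>y. y \<in> states \<phi> \<Longrightarrow> bellman \<phi> (f y) k y = g + k y" and x: "x \<in> states \<phi>"
  shows "ereal g \<le> opt_gain \<phi> x"
proof -
  have "(\<lambda>T. ereal (total_reward \<phi> (stationary \<phi> f) x T / real T)) \<longlonglongrightarrow> ereal g"
    using average_reward_lim[OF assms] by simp
  from lim_imp_Liminf[OF _ this]
  have "liminf (\<lambda>T. ereal (total_reward \<phi> (stationary \<phi> f) x T / real T)) = ereal g" by simp
  moreover have "liminf (\<lambda>T. ereal (total_reward \<phi> (stationary \<phi> f) x T / real T)) \<le> opt_gain \<phi> x"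
    unfolding opt_gain_def by (rule SUP_upper) (rule stationary_in_policies[OF wf f])
  ultimately show ?thesis by simp
qed

text \<open>The equality makes \<open>g\<close> the gain of \<open>f\<close>, and the inequality
  bounds every policy by \<open>g\<close>. It is placed outside the ergodic setting because it is
  applied to confusing MDPs.\<close>

lemma verification:
  assumes "\<And>y. y \<in> states \<phi> \<Longrightarrow> bellman \<phi> (f y) k y = g + k y"
    and "\<And>y a. y \<in> states \<phi> \<Longrightarrow> a \<in> actions \<phi> \<Longrightarrow> bellman \<phi> a k y \<le> g + k y"
  shows "f \<in> opt_policies \<phi>"
proof -
  have "ereal (gain \<phi> f x) = opt_gain \<phi> x" if "x \<in> states \<phi>" for x
    using gain_eq[OF assms(1) that] gain_le_opt_gain[OF assms(1) that] opt_gain_le[OF that assms(2)]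
    by simp
  then show ?thesis using f by (simp add: opt_policies_def)
qed

end

section \<open>Ergodic MDPs\<close>

locale ergodic_mdp = proper_mdp +
  assumes ergodic: "ergodic \<phi>"

locale ergodic_stationary = ergodic_mdp + stationary_mdp
begin

text \<open>The probability in \<open>ergodic\<close> is the expectation of an indicator of the
  state at time \<open>t\<close>, hence an iterate of the kernel.\<close>

sublocale irreducible_kernel "states \<phi>" ker
proof
  fix x y assume x: "x \<in> states \<phi>" and y: "y \<in> states \<phi>"
  interpret controlled_mdp \<phi> "stationary \<phi> f" x by (rule controlled[OF x])
  obtain t where t: "0 < \<P>(\<omega> in Tr. state_at t \<omega> = y)"
    using ergodic f x y unfolding ergodic_def by blast
  have "\<P>(\<omega> in Tr. state_at t \<omega> = y) = (\<integral>\<omega>. indicator {\<omega> \<in> space Tr. state_at t \<omega> = y} \<omega> \<partial>Tr)"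
    by (simp add: Collect_conj_eq Int_commute Int_left_commute)
  also have "\<dots> = (\<integral>\<omega>. indicator {y} (state_at t \<omega>) \<partial>Tr)"
    by (intro Bochner_Integration.integral_cong refl) (simp split: split_indicator)
  also have "\<dots> = (K ^^ t) (indicator {y}) x" by (rule state_expectation[OF x])
  finally show "\<exists>t. 0 < (K ^^ t) (indicator {y}) x" using t by auto
qed

text \<open>The expected excess reward up to time T is k x - (K ^^ T) k x. The iterates need not
  converge, but their averages tend to a number that does not depend on the starting state, namely
  the gain \<open>c\<close> in Poisson's equation for a suitable reward.\<close>

lemma bias_shift:
  assumes k: "\<And>y. y \<in> states \<phi> \<Longrightarrow> bellman \<phi> (f y) k y = g + k y"
  shows "\<exists>c. \<forall>x\<in>states \<phi>. bias \<phi> f x = k x - c"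
proof -
  \<comment> \<open>The reward is \<open>K k\<close> and not \<open>k\<close> because the Cesaro
    mean starts at T = 1, so the sum of the iterates of \<open>k\<close> is shifted by one.\<close>
  obtain c u where cu: "\<And>x. x \<in> states \<phi> \<Longrightarrow> c + u x = K k x + K u x"
    using poisson_equation[of "K k"] by auto
  have "bias \<phi> f x = k x - c" if x: "x \<in> states \<phi>" for x
  proof -
    interpret controlled_mdp \<phi> "stationary \<phi> f" x by (rule controlled[OF x])
    have "(\<integral>\<omega>. (\<Sum>t<T. reward_at t \<omega> - gain \<phi> f (state_at t \<omega>)) \<partial>Tr) = k x - (K ^^ T) k x" for T
    proof -
      have "(\<integral>\<omega>. (\<Sum>t<T. reward_at t \<omega> - gain \<phi> f (state_at t \<omega>)) \<partial>Tr)
          = (\<Sum>t<T. \<integral>\<omega>. reward_at t \<omega> - gain \<phi> f (state_at t \<omega>) \<partial>Tr)"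
        by (intro Bochner_Integration.integral_sum Bochner_Integration.integrable_diff
            reward_integrable state_integrable)
      also have "\<dots> = (\<Sum>t<T. \<integral>\<omega>. reward_at t \<omega> - g \<partial>Tr)"
        by (intro sum.cong Bochner_Integration.integral_cong refl)
           (simp add: gain_eq[OF k] state_at_def trajectory_coord)
      also have "\<dots> = (\<Sum>t<T. (K ^^ t) rew x - g)"
        by (simp add: reward_integrable prob_space reward_expectation[OF x])
      also have "\<dots> = k x - (K ^^ T) k x"
        using K_funpow_sum[OF _ x, of g k rew T] k by (simp add: sum_subtractf bellman_eq)
      finally show ?thesis .
    qed
    then have "bias \<phi> f x = lim (\<lambda>N. (\<Sum>T=1..N. k x - (K ^^ T) k x) / real N)"
      by (simp add: bias_def cesaro_lim_def)
    also have "\<dots> = k x - c"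
    proof (rule limI, rule Lim_transform_eventually)
      show "(\<lambda>N. k x - (\<Sum>t<N. (K ^^ t) (K k) x) / real N) \<longlonglongrightarrow> k x - c"
        by (intro tendsto_diff tendsto_const K_funpow_average[OF cu x])
      have "(\<Sum>T=1..N. (K ^^ T) k x) = (\<Sum>t<N. (K ^^ t) (K k) x)" for N
        by (simp add: sum.atLeast1_atMost_eq funpow_swap1)
      then show "\<forall>\<^sub>F N in sequentially. k x - (\<Sum>t<N. (K ^^ t) (K k) x) / real N
          = (\<Sum>T=1..N. k x - (K ^^ T) k x) / real N"
        by (auto simp: sum_subtractf field_simps intro!: eventually_sequentiallyI[of 1])
    qed
    finally show ?thesis .
  qed
  then show ?thesis by blast
qed

text \<open>Poisson's equation is invariant under adding a constant to its solution, so the bias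
  itself solves it.\<close>

lemma bias_poisson:
  obtains g where "\<And>x. x \<in> states \<phi> \<Longrightarrow> gain \<phi> f x = g"
    "\<And>x. x \<in> states \<phi> \<Longrightarrow> bellman \<phi> (f x) (bias \<phi> f) x = g + bias \<phi> f x"
proof -
  obtain g k where gk: "\<And>x. x \<in> states \<phi> \<Longrightarrow> bellman \<phi> (f x) k x = g + k x"
    using poisson_equation[of rew] by (metis bellman_eq)
  obtain c where c: "\<And>x. x \<in> states \<phi> \<Longrightarrow> bias \<phi> f x = k x - c" using bias_shift[OF gk] by auto
  have "bellman \<phi> (f x) (bias \<phi> f) x = g + bias \<phi> f x" if x: "x \<in> states \<phi>" for x
  proof -
    have "K (bias \<phi> f) x = K (\<lambda>y. k y - c) x" by (rule K_cong) (rule c)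
    then show ?thesis using gk[OF x] x by (simp add: bellman_eq K_diff K_const c)
  qed
  with gain_eq[OF gk] show ?thesis by (rule that)
qed

end

section \<open>Policy improvement and the optimality equation\<close>

context ergodic_mdp
begin

lemma ergodic_stationaryI: "f \<in> det_policies \<phi> \<Longrightarrow> ergodic_stationary \<phi> f"
  by unfold_locales

text \<open>The advantage \<open>w\<close> of the changed policy vanishes off \<open>x\<close> and
  is positive in \<open>x\<close>. Solve Poisson's equation of the new kernel for the reward
  \<open>w\<close>, with gain \<open>l\<close>: if l <= 0 the solution \<open>u\<close> is
  superharmonic, hence constant, and the equation in \<open>x\<close> gives l = w x > 0, a
  contradiction. Then \<open>k + u\<close> solves the equation of the new policy with gain
  \<open>g + l\<close>, the same in every state.\<close>

lemma policy_improvement: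
  assumes f: "f \<in> det_policies \<phi>"
    and k: "\<And>x. x \<in> states \<phi> \<Longrightarrow> bellman \<phi> (f x) k x = g + k x"
    and x: "x \<in> states \<phi>" and a: "a \<in> actions \<phi>" and better: "g + k x < bellman \<phi> a k x"
  shows "f(x := a) \<in> det_policies \<phi>" "y \<in> states \<phi> \<Longrightarrow> g < gain \<phi> (f(x := a)) y"
proof -
  let ?f = "f(x := a)"
  show f': "?f \<in> det_policies \<phi>"
    using f x a by (auto simp: det_policies_def PiE_iff extensional_def)
  interpret ergodic_stationary \<phi> ?f by (rule ergodic_stationaryI[OF f'])
  define w where "w z = bellman \<phi> (?f z) k z - g - k z" for z
  have w0: "w z = 0" if "z \<in> states \<phi>" "z \<noteq> x" for z using that k by (simp add: w_def)
  have wx: "0 < w x" using better by (simp add: w_def)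
  obtain l u where lu: "\<And>z. z \<in> states \<phi> \<Longrightarrow> l + u z = w z + K u z"
    using poisson_equation[of w] by blast
  have "l > 0"
  proof (rule ccontr)
    assume "\<not> l > 0"
    then have "K u z \<le> u z" if "z \<in> states \<phi>" for z
      using lu[OF that] w0[OF that] wx by (cases "z = x") auto
    from superharmonic_constant[OF this] obtain c where c: "\<And>z. z \<in> states \<phi> \<Longrightarrow> u z = c" by blast
    have "K u x = K (\<lambda>_. c) x" by (rule K_cong) (rule c)
    with lu[OF x] c[OF x] wx \<open>\<not> l > 0\<close> show False by (simp add: K_const x)
  qed
  moreover have "bellman \<phi> (?f z) (\<lambda>z. k z + u z) z = (g + l) + (k z + u z)" if "z \<in> states \<phi>" for z
    using lu[OF that] unfolding bellman_eq K_add w_def by simp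
  from gain_eq[OF this] have "gain \<phi> ?f y = g + l" if "y \<in> states \<phi>" for y using that by simp
  ultimately show "y \<in> states \<phi> \<Longrightarrow> g < gain \<phi> ?f y" by simp
qed

text \<open>Maximality at the single state \<open>z\<close> is enough, since an improving action
  anywhere raises the gain everywhere.\<close>

lemma bellman_le_if_gain_maximal:
  assumes f: "f \<in> det_policies \<phi>" and z: "z \<in> states \<phi>"
    and max: "\<And>f'. f' \<in> det_policies \<phi> \<Longrightarrow> gain \<phi> f' z \<le> gain \<phi> f z"
  obtains g where "\<And>x. x \<in> states \<phi> \<Longrightarrow> bellman \<phi> (f x) (bias \<phi> f) x = g + bias \<phi> f x"
    "\<And>x a. x \<in> states \<phi> \<Longrightarrow> a \<in> actions \<phi> \<Longrightarrow> bellman \<phi> a (bias \<phi> f) x \<le> g + bias \<phi> f x"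
proof -
  interpret ergodic_stationary \<phi> f by (rule ergodic_stationaryI[OF f])
  obtain g where g: "\<And>x. x \<in> states \<phi> \<Longrightarrow> gain \<phi> f x = g"
    "\<And>x. x \<in> states \<phi> \<Longrightarrow> bellman \<phi> (f x) (bias \<phi> f) x = g + bias \<phi> f x"
    using bias_poisson by blast
  have "bellman \<phi> a (bias \<phi> f) x \<le> g + bias \<phi> f x" if "x \<in> states \<phi>" "a \<in> actions \<phi>" for x a
    using policy_improvement[OF f g(2) that] max[of "f(x := a)"] g(1)[OF z] z
    by (metis leD leI)
  with g(2) show ?thesis by (rule that)
qed

text \<open>There are finitely many stationary deterministic policies. One with the largest gain at
  some fixed state solves the optimality equation and is therefore optimal among all
  policies.\<close>

lemma opt_policies_nonempty: "opt_policies \<phi> \<noteq> {}"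
proof -
  have fin: "finite (det_policies \<phi>)"
    unfolding det_policies_def by (intro finite_PiE finite_states finite_actions)
  obtain a where "a \<in> actions \<phi>" using actions_nonempty by blast
  then have ne: "det_policies \<phi> \<noteq> {}"
    unfolding det_policies_def PiE_eq_empty_iff by blast
  obtain z where z: "z \<in> states \<phi>" using states_nonempty by blast
  have "Max ((\<lambda>f. gain \<phi> f z) ` det_policies \<phi>) \<in> (\<lambda>f. gain \<phi> f z) ` det_policies \<phi>"
    using fin ne by (intro Max_in) auto
  then obtain f where f: "f \<in> det_policies \<phi>" "gain \<phi> f z = Max ((\<lambda>f. gain \<phi> f z) ` det_policies \<phi>)"
    by auto
  then have "gain \<phi> f' z \<le> gain \<phi> f z" if "f' \<in> det_policies \<phi>" for f'
    using fin that by simp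
  from bellman_le_if_gain_maximal[OF f(1) z this] obtain g where
    g: "\<And>x. x \<in> states \<phi> \<Longrightarrow> bellman \<phi> (f x) (bias \<phi> f) x = g + bias \<phi> f x"
    "\<And>x a. x \<in> states \<phi> \<Longrightarrow> a \<in> actions \<phi> \<Longrightarrow> bellman \<phi> a (bias \<phi> f) x \<le> g + bias \<phi> f x" by blast
  interpret ergodic_stationary \<phi> f by (rule ergodic_stationaryI[OF f(1)])
  from verification[OF g] show ?thesis by blast
qed

text \<open>Whichever policy the choice operator in \<open>opt_bias\<close> selects, it attains
  \<open>opt_gain\<close>, which dominates the gain of every stationary deterministic policy. The
  improvement argument therefore applies to it.\<close>

lemma opt_bias_bellman:
  obtains f g where "f \<in> opt_policies \<phi>"
    "\<And>x. x \<in> states \<phi> \<Longrightarrow> bellman \<phi> (f x) (opt_bias \<phi>) x = g + opt_bias \<phi> x"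
    "\<And>x a. x \<in> states \<phi> \<Longrightarrow> a \<in> actions \<phi> \<Longrightarrow> bellman \<phi> a (opt_bias \<phi>) x \<le> g + opt_bias \<phi> x"
proof -
  define f where "f = (SOME f. f \<in> opt_policies \<phi>)"
  have fo: "f \<in> opt_policies \<phi>"
    unfolding f_def using opt_policies_nonempty by (simp add: some_in_eq)
  then have fd: "f \<in> det_policies \<phi>" by (simp add: opt_policies_def)
  obtain z where z: "z \<in> states \<phi>" using states_nonempty by blast
  have "gain \<phi> f' z \<le> gain \<phi> f z" if f': "f' \<in> det_policies \<phi>" for f'
  proof -
    interpret ergodic_stationary \<phi> f' by (rule ergodic_stationaryI[OF f'])
    obtain g where g: "\<And>x. x \<in> states \<phi> \<Longrightarrow> gain \<phi> f' x = g"
      "\<And>x. x \<in> states \<phi> \<Longrightarrow> bellman \<phi> (f' x) (bias \<phi> f') x = g + bias \<phi> f' x"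
      using bias_poisson by blast
    have "ereal g \<le> ereal (gain \<phi> f z)"
      using gain_le_opt_gain[OF g(2) z] fo z by (simp add: opt_policies_def)
    then show ?thesis using g(1)[OF z] by simp
  qed
  from bellman_le_if_gain_maximal[OF fd z this] that[OF fo] show ?thesis
    unfolding opt_bias_def f_def by metis
qed

end

section \<open>Lower bounds on the divergence\<close>

lemma exp_le_quadratic:
  fixes c :: real
  assumes "\<bar>c\<bar> \<le> 1"
  shows "exp c \<le> 1 + c + c\<^sup>2"
proof (cases "0 \<le> c")
  case True
  then show ?thesis using assms exp_bound[of c] by simp
next
  case False
  define d where "d = - c"
  have d: "0 < d" "d \<le> 1" using False assms by (auto simp: d_def)
  \<comment> \<open>With c = - d the claim is 1 <= (1 - d + d^2) * exp d. Replacing exp d by its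
    second order Taylor polynomial and multiplying out leaves this expression.\<close>
  have "1 \<le> 1 + d^2 / 2 + d^3 / 2 + d^4 / 2" using d by simp
  also have "\<dots> = (1 - d + d\<^sup>2) * (1 + d + d\<^sup>2 / 2)" by (simp add: field_simps power2_eq_square power3_eq_cube power4_eq_xxxx)
  also have "\<dots> \<le> (1 - d + d\<^sup>2) * exp d"
    using d by (intro mult_left_mono exp_lower_Taylor_quadratic) auto
  finally show ?thesis by (simp add: d_def exp_minus field_simps)
qed

text \<open>
  Summed or integrated over two densities, this bounds the divergence by a quadratic in the size of
  \<open>c\<close>. Below \<open>c\<close> is \<open>v / 2 * sgn (p - q)\<close> for the transitions and \<open>2 * u * (r - 1 / 2)\<close> for the rewards, which
  yields \<open>v\<^sup>2 / 4\<close> and \<open>u\<^sup>2\<close>. The constant is worse than Pinsker's for \<open>v\<close>, but suffices because \<open>v\<close> enters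
  the Bellman operator only through \<open>H * v / 2\<close>.
\<close>

lemma log_ratio_lower_bound:
  fixes p q c :: real
  assumes "0 \<le> p" "0 \<le> q" "q = 0 \<Longrightarrow> p = 0" "\<bar>c\<bar> \<le> 1"
  shows "p * (1 + c) - q * (1 + c + c\<^sup>2) \<le> p * ln (p / q)"
proof (cases "p = 0")
  case True
  have "0 \<le> 1 + c + c\<^sup>2" using assms(4) by (simp add: abs_le_iff)
  then show ?thesis using True assms by simp
next
  case False
  with assms have pq: "0 < p" "0 < q" by (auto simp: less_le)
  \<comment> \<open>The variational lower bound for the divergence with test function
    \<open>c\<close>, taken pointwise: tangent inequality of the logarithm at q * exp c / p.\<close>
  have "ln (q * exp c / p) \<le> q * exp c / p - 1" using pq by (intro ln_le_minus_one) simp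
  then have "c + 1 - q * exp c / p \<le> ln (p / q)" using pq by (simp add: ln_mult ln_div)
  then have "p * (c + 1 - q * exp c / p) \<le> p * ln (p / q)" using pq by (intro mult_left_mono) auto
  moreover have "p * (c + 1 - q * exp c / p) = p * (1 + c) - q * exp c" using pq by (simp add: field_simps)
  moreover have "q * exp c \<le> q * (1 + c + c\<^sup>2)" using pq exp_le_quadratic[OF assms(4)] by simp
  ultimately show ?thesis by linarith
qed

lemma sum_log_ratio_lower_bound:
  fixes p q :: "'s \<Rightarrow> real"
  assumes "\<And>y. y \<in> S \<Longrightarrow> 0 \<le> p y" "\<And>y. y \<in> S \<Longrightarrow> 0 \<le> q y" "\<And>y. y \<in> S \<Longrightarrow> q y = 0 \<Longrightarrow> p y = 0"
    and "sum p S = 1" "sum q S = 1"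
  shows "(\<Sum>y\<in>S. \<bar>p y - q y\<bar>)\<^sup>2 / 4 \<le> (\<Sum>y\<in>S. p y * ln (p y / q y))"
proof -
  define v where "v = (\<Sum>y\<in>S. \<bar>p y - q y\<bar>)"
  have "v \<le> (\<Sum>y\<in>S. p y + q y)"
    unfolding v_def by (intro sum_mono) (use assms(1,2) in \<open>fastforce simp: abs_le_iff\<close>)
  then have v: "0 \<le> v" "v \<le> 2" using assms by (auto simp: sum.distrib v_def sum_nonneg)
  \<comment> \<open>A test function b * sgn (p - q) yields b * v - b^2, which is largest for b = v /
    2. The bound v <= 2 keeps it within the range where the quadratic estimate of exp holds.\<close>
  define c where "c y = v / 2 * sgn (p y - q y)" for y
  have c: "\<bar>c y\<bar> \<le> 1" for y using v by (auto simp: c_def sgn_real_def)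
  have "v\<^sup>2 / 4 = v / 2 * v - (v / 2)\<^sup>2 * sum q S + sum p S - sum q S"
    using assms by (simp add: power2_eq_square)
  also have "\<dots> = (\<Sum>y\<in>S. v / 2 * \<bar>p y - q y\<bar> - (v / 2)\<^sup>2 * q y + p y - q y)"
    unfolding sum.distrib sum_subtractf sum_distrib_left[symmetric] v_def[symmetric] ..
  also have "\<dots> \<le> (\<Sum>y\<in>S. p y * (1 + c y) - q y * (1 + c y + (c y)\<^sup>2))"
  proof (rule sum_mono)
    fix y assume "y \<in> S"
    have "(c y)\<^sup>2 \<le> (v / 2)\<^sup>2" by (simp add: c_def sgn_real_def power_mult_distrib)
    then have "q y * (c y)\<^sup>2 \<le> q y * (v / 2)\<^sup>2" using assms(2)[OF \<open>y \<in> S\<close>] by (rule mult_left_mono)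
    moreover have "v / 2 * \<bar>p y - q y\<bar> = c y * (p y - q y)" by (simp add: c_def abs_sgn mult_ac)
    ultimately show "v / 2 * \<bar>p y - q y\<bar> - (v / 2)\<^sup>2 * q y + p y - q y \<le> p y * (1 + c y) - q y * (1 + c y + (c y)\<^sup>2)"
      by (simp add: algebra_simps)
  qed
  also have "\<dots> \<le> (\<Sum>y\<in>S. p y * ln (p y / q y))"
    by (intro sum_mono log_ratio_lower_bound assms c)
  finally show ?thesis by (simp add: v_def)
qed

text \<open>The positive and negative parts are compared separately. Integrability of
  \<open>G\<close> keeps the left side a genuine difference of finite numbers, while the positive
  part of \<open>f\<close> may have infinite integral.\<close>

lemma ext_integral_ge:
  assumes "integrable M G" "AE r in M. G r \<le> f r"
  shows "ereal (\<integral>r. G r \<partial>M) \<le> ext_integral M f"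
proof -
  have fin: "(\<integral>\<^sup>+r. ennreal (G r) \<partial>M) < \<infinity>" "(\<integral>\<^sup>+r. ennreal (- G r) \<partial>M) < \<infinity>"
    using assms(1) integrable_iff_bounded real_integrable_def[of M G]
    by (auto simp: less_top)
  obtain b c where bc: "0 \<le> b" "(\<integral>\<^sup>+r. ennreal (G r) \<partial>M) = ennreal b"
    "0 \<le> c" "(\<integral>\<^sup>+r. ennreal (- G r) \<partial>M) = ennreal c"
    using fin by (metis ennreal_cases infinity_ennreal_def less_irrefl)
  then have "ereal (\<integral>r. G r \<partial>M) = enn2ereal (\<integral>\<^sup>+r. ennreal (G r) \<partial>M) - enn2ereal (\<integral>\<^sup>+r. ennreal (- G r) \<partial>M)"
    by (simp add: real_lebesgue_integral_def[OF assms(1)] enn2ereal_ennreal)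
  also have "\<dots> \<le> ext_integral M f"
    unfolding ext_integral_def
  proof (rule ereal_minus_mono)
    show "enn2ereal (\<integral>\<^sup>+r. ennreal (G r) \<partial>M) \<le> enn2ereal (\<integral>\<^sup>+r. ennreal (f r) \<partial>M)"
      unfolding less_eq_ennreal.rep_eq[symmetric]
      by (rule nn_integral_mono_AE, rule AE_mp[OF assms(2)], intro AE_I2 impI ennreal_leI) simp
    show "enn2ereal (\<integral>\<^sup>+r. ennreal (- f r) \<partial>M) \<le> enn2ereal (\<integral>\<^sup>+r. ennreal (- G r) \<partial>M)"
      unfolding less_eq_ennreal.rep_eq[symmetric]
      by (rule nn_integral_mono_AE, rule AE_mp[OF assms(2)], intro AE_I2 impI ennreal_leI) simp
  qed
  finally show ?thesis .
qed

section \<open>Two MDPs compared through divergences and Bellman operators\<close>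

locale mdp_pair = \<phi>: proper_mdp \<phi> + \<psi>: proper_mdp \<psi>
  for \<phi> \<psi> :: "('s, 'a) mdp" +
  assumes states_eq: "states \<psi> = states \<phi>" and actions_eq: "actions \<psi> = actions \<phi>"
    and base_eq: "base \<psi> = base \<phi>"
    and ac: "mdp_ac \<phi> \<psi>"
begin

definition tdiff :: "'s \<Rightarrow> 'a \<Rightarrow> real" where
  "tdiff x a = (\<Sum>y\<in>states \<phi>. \<bar>pmf (tpmf \<phi> x a) y - pmf (tpmf \<psi> x a) y\<bar>)"

definition rdiff :: "'s \<Rightarrow> 'a \<Rightarrow> real" where
  "rdiff x a = \<bar>mean_reward \<phi> x a - mean_reward \<psi> x a\<bar>"

lemma transition_kl_ge:
  assumes x: "x \<in> states \<phi>" and a: "a \<in> actions \<phi>"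
  shows "(tdiff x a)\<^sup>2 / 4 \<le>
    (\<Sum>y\<in>states \<phi>. pmf (tpmf \<phi> x a) y * ln (pmf (tpmf \<phi> x a) y / pmf (tpmf \<psi> x a) y))"
  unfolding tdiff_def
proof (rule sum_log_ratio_lower_bound)
  fix y assume "pmf (tpmf \<psi> x a) y = 0"
  then have "{y} \<in> null_sets (measure_pmf (tpmf \<psi> x a))" by (simp add: null_sets_def emeasure_pmf_single)
  then have "{y} \<in> null_sets (measure_pmf (tpmf \<phi> x a))"
    using ac x a by (auto simp: mdp_ac_def absolutely_continuous_def)
  then show "pmf (tpmf \<phi> x a) y = 0" by (simp add: null_sets_def emeasure_pmf_single)
qed (use \<phi>.sum_tpmf[OF x a] \<psi>.sum_tpmf[of x a] x a in \<open>simp_all add: states_eq actions_eq\<close>)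

lemma reward_kl_ge:
  assumes x: "x \<in> states \<phi>" and a: "a \<in> actions \<phi>"
  shows "ereal ((rdiff x a)\<^sup>2) \<le>
    ext_integral (base \<phi>) (\<lambda>r. rdens \<phi> x a r * ln (rdens \<phi> x a r / rdens \<psi> x a r))"
proof -
  have x': "x \<in> states \<psi>" and a': "a \<in> actions \<psi>" using x a by (simp_all add: states_eq actions_eq)
  interpret P: prob_space "rdistr \<phi> x a" by (rule \<phi>.prob_space_rdistr[OF x a])
  interpret Q: prob_space "rdistr \<psi> x a" by (rule \<psi>.prob_space_rdistr[OF x' a'])
  define u where "u = mean_reward \<phi> x a - mean_reward \<psi> x a"
  have u: "\<bar>u\<bar> \<le> 1"
    using \<phi>.mean_reward_bounds[OF x a] \<psi>.mean_reward_bounds[OF x' a'] by (simp add: u_def abs_le_iff)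
  \<comment> \<open>Centring at 1 / 2 gives \<bar>c\<bar> <= \<bar>u\<bar> <= 1 on the unit
    interval. The means of \<open>c\<close> under the two laws differ by 2 * u^2, and the quadratic
    term costs at most u^2.\<close>
  define c where "c r = 2 * u * (r - 1 / 2)" for r
  have c_le: "\<bar>c r\<bar> \<le> \<bar>u\<bar>" if "r \<in> {0..1}" for r
  proof -
    have "\<bar>u\<bar> * \<bar>2 * (r - 1 / 2)\<bar> \<le> \<bar>u\<bar> * 1" by (rule mult_left_mono) (use that in \<open>auto simp: abs_le_iff\<close>)
    then show ?thesis by (simp add: c_def abs_mult mult_ac)
  qed
  have c1: "\<bar>c r\<bar> \<le> 1" if "r \<in> {0..1}" for r using c_le[OF that] u by linarith
  have c_meas: "c \<in> borel_measurable (base \<phi>)"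
    unfolding c_def[abs_def] using \<phi>.id_measurable_base by measurable
  have p[measurable]: "rdens \<phi> x a \<in> borel_measurable (base \<phi>)" by (rule \<phi>.rdens_measurable[OF x a])
  have q[measurable]: "rdens \<psi> x a \<in> borel_measurable (base \<phi>)"
    using \<psi>.rdens_measurable[OF x' a'] by (simp add: base_eq)
  have p0: "0 \<le> rdens \<phi> x a r" "0 \<le> rdens \<psi> x a r" if "r \<in> {0..1}" for r
    using that \<phi>.rdens_nonneg[OF x a] \<psi>.rdens_nonneg[OF x' a'] by (auto simp: \<phi>.space_base \<psi>.space_base)
  have meas: "f \<in> borel_measurable (rdistr \<phi> x a)" "f \<in> borel_measurable (rdistr \<psi> x a)"
    if "f \<in> borel_measurable (base \<phi>)" for f :: "real \<Rightarrow> real"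
    using that by (simp_all add: rdistr_def base_eq)
  have int: "integrable (rdistr \<phi> x a) f" "integrable (rdistr \<psi> x a) f"
    if "f \<in> borel_measurable (base \<phi>)" "\<And>r. r \<in> {0..1} \<Longrightarrow> \<bar>f r\<bar> \<le> B" for f :: "real \<Rightarrow> real" and B
    by (rule P.integrable_const_bound[where B = B] Q.integrable_const_bound[where B = B],
        rule AE_I2, simp add: \<phi>.space_rdistr \<psi>.space_rdistr that(2), rule meas, rule that(1))+
  note c_meas[measurable]
  have c2: "(c r)\<^sup>2 \<le> u\<^sup>2" if "r \<in> {0..1}" for r using c_le[OF that] by (simp add: abs_le_square_iff)
  have ic: "integrable (rdistr \<phi> x a) c" "integrable (rdistr \<psi> x a) c" using int[OF c_meas c1] by simp_all
  have ic2: "integrable (rdistr \<psi> x a) (\<lambda>r. (c r)\<^sup>2)"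
    by (rule int(2)[of _ "u\<^sup>2"]) (auto simp: c2)
  have idp: "integrable (rdistr \<phi> x a) (\<lambda>r. r)" "integrable (rdistr \<psi> x a) (\<lambda>r. r)"
    by (rule \<phi>.integrable_rdistr_id[OF x a] \<psi>.integrable_rdistr_id[OF x' a'])+
  have mc: "(\<integral>r. c r \<partial>rdistr \<phi> x a) = 2 * u * (mean_reward \<phi> x a - 1 / 2)"
    "(\<integral>r. c r \<partial>rdistr \<psi> x a) = 2 * u * (mean_reward \<psi> x a - 1 / 2)"
    by (simp_all add: c_def idp P.prob_space Q.prob_space \<phi>.mean_reward_eq[OF x a] \<psi>.mean_reward_eq[OF x' a'])
  have mc2: "(\<integral>r. (c r)\<^sup>2 \<partial>rdistr \<psi> x a) \<le> u\<^sup>2"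
    by (rule Q.integral_le_const[OF ic2]) (auto simp: \<psi>.space_rdistr c2 intro!: AE_I2)
  define G where "G r = rdens \<phi> x a r * (1 + c r) - rdens \<psi> x a r * (1 + c r + (c r)\<^sup>2)" for r
  have ae: "AE r in base \<phi>. 0 \<le> rdens \<phi> x a r" "AE r in base \<phi>. 0 \<le> rdens \<psi> x a r"
    by (auto intro!: AE_I2 p0 simp: \<phi>.space_base)
  have i1: "integrable (rdistr \<phi> x a) (\<lambda>r. 1 + c r)"
    by (intro Bochner_Integration.integrable_add P.integrable_const ic)
  have i2: "integrable (rdistr \<psi> x a) (\<lambda>r. 1 + c r + (c r)\<^sup>2)"
    by (intro Bochner_Integration.integrable_add Q.integrable_const ic ic2)
  have G1: "integrable (base \<phi>) (\<lambda>r. rdens \<phi> x a r * (1 + c r))"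
    using i1 unfolding rdistr_def by (subst (asm) integrable_density) (simp_all add: ae)
  have G2: "integrable (base \<phi>) (\<lambda>r. rdens \<psi> x a r * (1 + c r + (c r)\<^sup>2))"
    using i2 unfolding rdistr_def base_eq by (subst (asm) integrable_density) (simp_all add: ae)
  have "integrable (base \<phi>) G" unfolding G_def by (rule Bochner_Integration.integrable_diff[OF G1 G2])
  moreover have "AE r in base \<phi>. G r \<le> rdens \<phi> x a r * ln (rdens \<phi> x a r / rdens \<psi> x a r)"
  proof -
    \<comment> \<open>The pointwise bound requires p = 0 wherever q = 0. This holds only almost
      everywhere: the law of \<open>\<psi>\<close> does not charge the zeros of its own density,
      hence by absolute continuity neither does the law of \<open>\<phi>\<close>.\<close>
    have "AE r in rdistr \<psi> x a. rdens \<psi> x a r \<noteq> 0"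
      unfolding rdistr_def base_eq by (subst AE_density) auto
    then have "AE r in rdistr \<phi> x a. rdens \<psi> x a r \<noteq> 0"
      by (rule absolutely_continuous_AE[rotated 2]) (use ac x a in \<open>auto simp: mdp_ac_def \<phi>.sets_rdistr \<psi>.sets_rdistr\<close>)
    then have "AE r in base \<phi>. 0 < rdens \<phi> x a r \<longrightarrow> rdens \<psi> x a r \<noteq> 0"
      unfolding rdistr_def by (subst (asm) AE_density) auto
    then show ?thesis
    proof (rule AE_mp, intro AE_I2 impI)
      fix r assume r: "r \<in> space (base \<phi>)" "0 < rdens \<phi> x a r \<longrightarrow> rdens \<psi> x a r \<noteq> 0"
      then have r': "r \<in> {0..1}" by (simp add: \<phi>.space_base)
      show "G r \<le> rdens \<phi> x a r * ln (rdens \<phi> x a r / rdens \<psi> x a r)"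
        unfolding G_def by (rule log_ratio_lower_bound) (use p0[OF r'] c1[OF r'] r(2) in force)+
    qed
  qed
  ultimately have "ereal (\<integral>r. G r \<partial>base \<phi>)
      \<le> ext_integral (base \<phi>) (\<lambda>r. rdens \<phi> x a r * ln (rdens \<phi> x a r / rdens \<psi> x a r))"
    by (rule ext_integral_ge)
  moreover have "u\<^sup>2 \<le> (\<integral>r. G r \<partial>base \<phi>)"
  proof -
    have "(\<integral>r. G r \<partial>base \<phi>) = (\<integral>r. 1 + c r \<partial>rdistr \<phi> x a) - (\<integral>r. 1 + c r + (c r)\<^sup>2 \<partial>rdistr \<psi> x a)"
      unfolding G_def Bochner_Integration.integral_diff[OF G1 G2]
      by (subst \<phi>.integral_rdistr[OF x a], simp, subst \<psi>.integral_rdistr[OF x' a']) (simp_all add: base_eq)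
    also have "\<dots> = 2 * u * (mean_reward \<phi> x a - mean_reward \<psi> x a) - (\<integral>r. (c r)\<^sup>2 \<partial>rdistr \<psi> x a)"
      using ic ic2 by (simp add: mc P.prob_space Q.prob_space algebra_simps)
    also have "\<dots> \<ge> 2 * u * u - u\<^sup>2" using mc2 by (simp add: u_def)
    finally show ?thesis by (simp add: power2_eq_square)
  qed
  ultimately show ?thesis
    by (simp add: rdiff_def u_def) (meson ereal_less_eq(3) order_trans)
qed

lemma kl_ge:
  assumes "x \<in> states \<phi>" "a \<in> actions \<phi>"
  shows "ereal ((tdiff x a)\<^sup>2 / 4 + (rdiff x a)\<^sup>2) \<le> kl \<phi> \<psi> x a"
  unfolding kl_def plus_ereal.simps(1)[symmetric]
  by (intro add_mono reward_kl_ge assms) (simp only: ereal_less_eq transition_kl_ge assms)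

lemma kl_nonneg:
  assumes "x \<in> states \<phi>" "a \<in> actions \<phi>"
  shows "0 \<le> kl \<phi> \<psi> x a"
  using kl_ge[OF assms] by (rule order_trans[rotated]) simp

text \<open>The lower bound forces equal transition probabilities and equal mean rewards, and the
  Bellman operator sees the reward law through its mean only.\<close>

lemma bellman_eq_if_kl_0:
  assumes x: "x \<in> states \<phi>" and a: "a \<in> actions \<phi>" and "kl \<phi> \<psi> x a = 0"
  shows "bellman \<psi> a h x = bellman \<phi> a h x"
proof -
  have "(tdiff x a)\<^sup>2 / 4 + (rdiff x a)\<^sup>2 \<le> 0" using kl_ge[OF x a] assms(3) by simp
  moreover have "0 \<le> (tdiff x a)\<^sup>2" "0 \<le> (rdiff x a)\<^sup>2" by simp_all
  ultimately have "(tdiff x a)\<^sup>2 = 0" "(rdiff x a)\<^sup>2 = 0" by linarith+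
  then have "tdiff x a = 0" "rdiff x a = 0" by simp_all
  then have "mean_reward \<phi> x a = mean_reward \<psi> x a"
    "\<forall>y\<in>states \<phi>. pmf (tpmf \<phi> x a) y = pmf (tpmf \<psi> x a) y"
    using \<phi>.finite_states by (simp_all add: tdiff_def rdiff_def sum_nonneg_eq_0_iff)
  then show ?thesis by (simp add: bellman_def states_eq)
qed

lemma bellman_diff_le:
  assumes x: "x \<in> states \<phi>" and a: "a \<in> actions \<phi>"
    and span: "\<And>y z. y \<in> states \<phi> \<Longrightarrow> z \<in> states \<phi> \<Longrightarrow> h y - h z \<le> H"
  shows "bellman \<psi> a h x - bellman \<phi> a h x \<le> rdiff x a + H * (tdiff x a / 2)"
proof -
  define l where "l = Min (h ` states \<phi>)"
  have "l \<in> h ` states \<phi>" unfolding l_def using \<phi>.finite_states \<phi>.states_nonempty by (intro Min_in) auto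
  then obtain z where z: "z \<in> states \<phi>" "h z = l" by auto
  have l: "l \<le> h y" if "y \<in> states \<phi>" for y using that \<phi>.finite_states by (simp add: l_def)
  \<comment> \<open>The differences of transition probabilities sum to 0, so \<open>h\<close> may be
    shifted by a constant. Shifting by the middle of its range leaves a function bounded by H / 2
    and thus produces half of \<open>tdiff\<close>.\<close>
  define m where "m = l + H / 2"
  define k where "k y = h y - m" for y
  have k: "\<bar>k y\<bar> \<le> H / 2" if "y \<in> states \<phi>" for y
    using l[OF that] span[OF that z(1)] z unfolding k_def m_def abs_le_iff by (simp add: field_simps)
  let ?d = "\<lambda>y. pmf (tpmf \<psi> x a) y - pmf (tpmf \<phi> x a) y"
  have "sum ?d (states \<phi>) = 0"
    using \<phi>.sum_tpmf[OF x a] \<psi>.sum_tpmf[of x a] x a by (simp add: sum_subtractf states_eq actions_eq)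
  then have "(\<Sum>y\<in>states \<phi>. ?d y * h y) = (\<Sum>y\<in>states \<phi>. ?d y * k y)"
    by (simp add: k_def right_diff_distrib sum_subtractf flip: sum_distrib_right)
  also have "\<dots> \<le> (\<Sum>y\<in>states \<phi>. \<bar>?d y\<bar> * (H / 2))"
  proof (rule sum_mono)
    fix y assume y: "y \<in> states \<phi>"
    have "?d y * k y \<le> \<bar>?d y\<bar> * \<bar>k y\<bar>" by (metis abs_ge_self abs_mult)
    also have "\<dots> \<le> \<bar>?d y\<bar> * (H / 2)" by (intro mult_left_mono k y) simp
    finally show "?d y * k y \<le> \<bar>?d y\<bar> * (H / 2)" .
  qed
  also have "\<dots> = H * (tdiff x a / 2)"
    unfolding sum_distrib_right[symmetric] tdiff_def by (simp add: abs_minus_commute)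
  finally have "(\<Sum>y\<in>states \<phi>. pmf (tpmf \<psi> x a) y * h y) - (\<Sum>y\<in>states \<phi>. pmf (tpmf \<phi> x a) y * h y)
      \<le> H * (tdiff x a / 2)"
    by (simp add: left_diff_distrib sum_subtractf)
  then show ?thesis by (simp add: bellman_def states_eq rdiff_def)
qed

end

section \<open>The Lipschitz structure\<close>

context ergodic_mdp
begin

lemma opt_bellman_eq:
  obtains f g where "f \<in> opt_policies \<phi>" "\<And>x. x \<in> states \<phi> \<Longrightarrow> f x \<in> opt_actions \<phi> x"
    "\<And>x. x \<in> states \<phi> \<Longrightarrow> opt_bellman \<phi> (opt_bias \<phi>) x = g + opt_bias \<phi> x"
proof -
  obtain f g where f: "f \<in> opt_policies \<phi>"
    and eq: "\<And>x. x \<in> states \<phi> \<Longrightarrow> bellman \<phi> (f x) (opt_bias \<phi>) x = g + opt_bias \<phi> x"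
    and le: "\<And>x a. x \<in> states \<phi> \<Longrightarrow> a \<in> actions \<phi> \<Longrightarrow> bellman \<phi> a (opt_bias \<phi>) x \<le> g + opt_bias \<phi> x"
    by (rule opt_bias_bellman) blast
  have fa: "f x \<in> actions \<phi>" if "x \<in> states \<phi>" for x
    using f that by (auto simp: opt_policies_def det_policies_def)
  have o: "opt_bellman \<phi> (opt_bias \<phi>) x = g + opt_bias \<phi> x" if "x \<in> states \<phi>" for x
    unfolding opt_bellman_def
  proof (rule Max_eqI)
    show "finite ((\<lambda>a. bellman \<phi> a (opt_bias \<phi>) x) ` actions \<phi>)" using finite_actions by simp
    show "g + opt_bias \<phi> x \<in> (\<lambda>a. bellman \<phi> a (opt_bias \<phi>) x) ` actions \<phi>"
      using eq[OF that] fa[OF that] by (metis imageI)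
  qed (use le[OF that] in auto)
  show ?thesis
    by (rule that[OF f _ o]) (simp_all add: opt_actions_def fa o eq)
qed

end

context proper_mdp
begin

lemma opt_bias_span: "x \<in> states \<phi> \<Longrightarrow> y \<in> states \<phi> \<Longrightarrow> opt_bias \<phi> x - opt_bias \<phi> y \<le> bias_span \<phi>"
proof -
  assume "x \<in> states \<phi>" "y \<in> states \<phi>"
  moreover have "{opt_bias \<phi> x - opt_bias \<phi> y |x y. x \<in> states \<phi> \<and> y \<in> states \<phi>}
      = (\<lambda>(x, y). opt_bias \<phi> x - opt_bias \<phi> y) ` (states \<phi> \<times> states \<phi>)" by auto
  ultimately show ?thesis
    unfolding bias_span_def using finite_states by (intro Max_ge) auto
qed

lemma bias_span_nonneg: "0 \<le> bias_span \<phi>"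
proof -
  obtain x where "x \<in> states \<phi>" using states_nonempty by blast
  from opt_bias_span[OF this this] show ?thesis by simp
qed

lemma gap_nonneg: "a \<in> actions \<phi> \<Longrightarrow> 0 \<le> gap \<phi> x a"
  using finite_actions by (simp add: gap_def opt_bellman_def)

lemma opt_actions_iff: "a \<in> opt_actions \<phi> x \<longleftrightarrow> a \<in> actions \<phi> \<and> gap \<phi> x a = 0"
  by (auto simp: opt_actions_def gap_def)

lemma gap_pos_iff: "a \<in> actions \<phi> \<Longrightarrow> 0 < gap \<phi> x a \<longleftrightarrow> a \<notin> opt_actions \<phi> x"
  using gap_nonneg[of a x] by (auto simp: opt_actions_iff)

text \<open>Mean rewards lie in [0, 1] and averages of the bias between its minimum and its minimum
  plus the span, so all Bellman values in a state lie in one interval of length H + 1.\<close>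

lemma gap_le:
  assumes x: "x \<in> states \<phi>" and a: "a \<in> actions \<phi>"
  shows "gap \<phi> x a \<le> bias_span \<phi> + 1"
proof -
  let ?h = "opt_bias \<phi>"
  have "opt_bellman \<phi> ?h x \<in> (\<lambda>a. bellman \<phi> a ?h x) ` actions \<phi>"
    unfolding opt_bellman_def using finite_actions actions_nonempty by (intro Max_in) auto
  then obtain b where b: "b \<in> actions \<phi>" "opt_bellman \<phi> ?h x = bellman \<phi> b ?h x" by auto
  obtain z where z: "z \<in> states \<phi>" "\<And>y. y \<in> states \<phi> \<Longrightarrow> ?h z \<le> ?h y"
    using finite_states states_nonempty by (metis ex_min_if_finite linorder_not_le arg_min_if_finite)
  have "(\<Sum>y\<in>states \<phi>. pmf (tpmf \<phi> x b) y * ?h y) \<le> (\<Sum>y\<in>states \<phi>. pmf (tpmf \<phi> x b) y * (?h z + bias_span \<phi>))"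
    using opt_bias_span[OF _ z(1)] by (intro sum_mono mult_left_mono) (auto simp: algebra_simps)
  also have "\<dots> = ?h z + bias_span \<phi>" by (simp add: sum_tpmf x b flip: sum_distrib_right)
  finally have "bellman \<phi> b ?h x \<le> 1 + ?h z + bias_span \<phi>"
    using mean_reward_bounds[OF x b(1)] by (simp add: bellman_def)
  moreover have "(\<Sum>y\<in>states \<phi>. pmf (tpmf \<phi> x a) y * ?h z) \<le> (\<Sum>y\<in>states \<phi>. pmf (tpmf \<phi> x a) y * ?h y)"
    by (intro sum_mono mult_left_mono z) auto
  then have "?h z \<le> bellman \<phi> a ?h x"
    using mean_reward_bounds[OF x a] by (simp add: bellman_def sum_tpmf x a flip: sum_distrib_right)
  ultimately show ?thesis by (simp add: gap_def b)
qed

lemma finite_pos_gaps: "finite (pos_gaps \<phi>)"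
proof (rule finite_subset)
  show "pos_gaps \<phi> \<subseteq> (\<lambda>(x, a). gap \<phi> x a) ` (states \<phi> \<times> actions \<phi>)"
    by (auto simp: pos_gaps_def)
qed (simp add: finite_states finite_actions)

lemma min_gap_le:
  assumes "x \<in> states \<phi>" "a \<in> actions \<phi> - opt_actions \<phi> x"
  shows "min_gap \<phi> \<le> gap \<phi> x a"
proof -
  have "0 < gap \<phi> x a" using assms gap_pos_iff by blast
  then have "gap \<phi> x a \<in> pos_gaps \<phi>" using assms unfolding pos_gaps_def by blast
  with finite_pos_gaps show ?thesis by (simp add: min_gap_def)
qed

lemma min_gap_pos: "pos_gaps \<phi> \<noteq> {} \<Longrightarrow> 0 < min_gap \<phi>"
proof -
  assume ne: "pos_gaps \<phi> \<noteq> {}"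
  from Min_in[OF finite_pos_gaps ne] show ?thesis by (auto simp: min_gap_def pos_gaps_def)
qed

end

section \<open>Confusing MDPs within the Lipschitz structure\<close>

lemma lipschitz_mdp_pair:
  assumes "\<phi> \<in> lipschitz_mdps S A lam L L' \<alpha> \<alpha>'" "\<psi> \<in> confusing (lipschitz_mdps S A lam L L' \<alpha> \<alpha>') \<phi>"
  shows "mdp_pair \<phi> \<psi>"
proof -
  have "wf_mdp \<phi>" "states \<phi> = S" "actions \<phi> = A" "base \<phi> = lam"
    using assms(1) by (simp_all add: lipschitz_mdps_def)
  moreover have "wf_mdp \<psi>" "states \<psi> = S" "actions \<psi> = A" "base \<psi> = lam" "mdp_ac \<phi> \<psi>"
    using assms(2) by (simp_all add: lipschitz_mdps_def confusing_def)
  ultimately show ?thesis by unfold_locales simp_all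
qed

lemma confusing_improves_action:
  assumes "ergodic_mdp \<phi>" "mdp_pair \<phi> \<psi>" "\<psi> \<in> confusing \<Phi> \<phi>"
  obtains x a where "x \<in> states \<phi>" "a \<in> actions \<phi> - opt_actions \<phi> x"
    "gap \<phi> x a < bellman \<psi> a (opt_bias \<phi>) x - bellman \<phi> a (opt_bias \<phi>) x"
proof -
  interpret ergodic_mdp \<phi> by fact
  interpret mdp_pair \<phi> \<psi> by fact
  obtain f g where f: "f \<in> opt_policies \<phi>" "\<And>x. x \<in> states \<phi> \<Longrightarrow> f x \<in> opt_actions \<phi> x"
    and g: "\<And>x. x \<in> states \<phi> \<Longrightarrow> opt_bellman \<phi> (opt_bias \<phi>) x = g + opt_bias \<phi> x"
    by (rule opt_bellman_eq) blast
  have same: "bellman \<psi> a (opt_bias \<phi>) x = g + opt_bias \<phi> x" if "x \<in> states \<phi>" "a \<in> opt_actions \<phi> x" for x a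
  proof -
    have "a \<in> actions \<phi>" "kl \<phi> \<psi> x a = 0"
      using that assms(3) by (auto simp: opt_actions_def confusing_def)
    from bellman_eq_if_kl_0[OF that(1) this] show ?thesis
      using that g by (simp add: opt_actions_def)
  qed
  have "f \<notin> opt_policies \<psi>" using f(1) assms(3) by (auto simp: confusing_def)
  moreover have "f \<in> det_policies \<psi>"
    using f(1) by (simp add: opt_policies_def det_policies_def states_eq actions_eq)
  then interpret F: stationary_mdp \<psi> f by unfold_locales
  \<comment> \<open>The gain \<open>g\<close> and bias of \<open>\<phi>\<close> serve as certificate
    for \<open>\<psi>\<close>: along \<open>f\<close> the divergence is 0, so the equality carries
    over, and only the inequality for other actions can fail.\<close>
  have "f \<in> opt_policies \<psi>"
    if "\<And>x a. x \<in> states \<psi> \<Longrightarrow> a \<in> actions \<psi> \<Longrightarrow> bellman \<psi> a (opt_bias \<phi>) x \<le> g + opt_bias \<phi> x"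
    by (rule F.verification[OF same that]) (use f(2) in \<open>simp_all add: states_eq\<close>)
  ultimately obtain x a where xa: "x \<in> states \<phi>" "a \<in> actions \<phi>"
    "g + opt_bias \<phi> x < bellman \<psi> a (opt_bias \<phi>) x"
    by (metis states_eq actions_eq not_le)
  then have "a \<notin> opt_actions \<phi> x" using same by force
  with xa show ?thesis by (intro that[of x a]) (auto simp: gap_def g)
qed

lemma lip_term_le_kl:
  assumes pair: "mdp_pair \<phi> \<psi>"
    and lip: "\<phi> \<in> lipschitz_mdps S A lam L L' \<alpha> \<alpha>'" "\<psi> \<in> lipschitz_mdps S A lam L L' \<alpha> \<alpha>'"
    and x: "x \<in> states \<phi>" and a: "a \<in> actions \<phi>" and x': "x' \<in> states \<phi>" and a': "a' \<in> actions \<phi>"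
    and imp: "gap \<phi> x' a' < bellman \<psi> a' (opt_bias \<phi>) x' - bellman \<phi> a' (opt_bias \<phi>) x'"
  shows "ereal ((max 0 (gap \<phi> x' a' / (bias_span \<phi> + 1) - 2 * lip_bound L L' \<alpha> \<alpha>' x a x' a'))\<^sup>2) \<le> kl \<phi> \<psi> x a"
proof -
  interpret mdp_pair \<phi> \<psi> by (rule pair)
  let ?H = "bias_span \<phi>" and ?l = "lip_bound L L' \<alpha> \<alpha>' x a x' a'"
  have SA: "x \<in> S" "a \<in> A" "x' \<in> S" "a' \<in> A" "states \<phi> = S"
    using lip(1) x a x' a' by (auto simp: lipschitz_mdps_def)
  have H: "0 \<le> ?H" by (rule \<phi>.bias_span_nonneg)
  have r1: "\<bar>mean_reward \<phi> x a - mean_reward \<phi> x' a'\<bar> \<le> ?l" "\<bar>mean_reward \<psi> x a - mean_reward \<psi> x' a'\<bar> \<le> ?l"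
    and p1: "(\<Sum>y\<in>S. \<bar>pmf (tpmf \<phi> x a) y - pmf (tpmf \<phi> x' a') y\<bar>) \<le> ?l"
      "(\<Sum>y\<in>S. \<bar>pmf (tpmf \<psi> x a) y - pmf (tpmf \<psi> x' a') y\<bar>) \<le> ?l"
    using lip SA unfolding lipschitz_mdps_def by blast+
  have l0: "0 \<le> ?l" using r1(1) by linarith
  have rd: "rdiff x' a' \<le> rdiff x a + 2 * ?l" using r1 unfolding rdiff_def by linarith
  have "tdiff x' a' \<le> (\<Sum>y\<in>S. \<bar>pmf (tpmf \<phi> x a) y - pmf (tpmf \<phi> x' a') y\<bar> +
      \<bar>pmf (tpmf \<phi> x a) y - pmf (tpmf \<psi> x a) y\<bar> + \<bar>pmf (tpmf \<psi> x a) y - pmf (tpmf \<psi> x' a') y\<bar>)"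
    unfolding tdiff_def SA(5) by (intro sum_mono) linarith
  then have td: "tdiff x' a' \<le> tdiff x a + 2 * ?l"
    using p1 by (simp add: sum.distrib tdiff_def SA(5))
  have "gap \<phi> x' a' \<le> rdiff x' a' + ?H * (tdiff x' a' / 2)"
    using imp bellman_diff_le[of x' a' "opt_bias \<phi>" "bias_span \<phi>", OF x' a' \<phi>.opt_bias_span] by linarith
  \<comment> \<open>Bounding both differences by their maximum turns the weights 1 and H into the
    single factor H + 1.\<close>
  also have "\<dots> \<le> 1 * max (rdiff x' a') (tdiff x' a' / 2) + ?H * max (rdiff x' a') (tdiff x' a' / 2)"
    using H by (intro add_mono mult_left_mono) auto
  finally have "gap \<phi> x' a' / (?H + 1) \<le> max (rdiff x' a') (tdiff x' a' / 2)"
    using H by (simp add: field_simps)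
  \<comment> \<open>Going from one pair to the other costs the Lipschitz bound once for
    \<open>\<phi>\<close> and once for \<open>\<psi>\<close>.\<close>
  moreover have "max (rdiff x' a') (tdiff x' a' / 2) \<le> max (rdiff x a) (tdiff x a / 2) + 2 * ?l"
    using rd td l0 max.cobounded1[of "rdiff x a" "tdiff x a / 2"] max.cobounded2[of "tdiff x a / 2" "rdiff x a"]
    by (intro max.boundedI) linarith+
  ultimately have "gap \<phi> x' a' / (?H + 1) - 2 * ?l \<le> max (rdiff x a) (tdiff x a / 2)"
    by linarith
  moreover have nn: "0 \<le> rdiff x a" "0 \<le> tdiff x a" by (auto simp: rdiff_def tdiff_def sum_nonneg)
  ultimately have "(max 0 (gap \<phi> x' a' / (?H + 1) - 2 * ?l))\<^sup>2 \<le> (max (rdiff x a) (tdiff x a / 2))\<^sup>2"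
    by (intro power_mono) auto
  \<comment> \<open>The square of a maximum is at most the sum of the squares, which is the form of
    \<open>kl_ge\<close>.\<close>
  also have "\<dots> \<le> (tdiff x a)\<^sup>2 / 4 + (rdiff x a)\<^sup>2"
    by (auto simp: max_def power_divide)
  finally have "ereal ((max 0 (gap \<phi> x' a' / (?H + 1) - 2 * ?l))\<^sup>2)
      \<le> ereal ((tdiff x a)\<^sup>2 / 4 + (rdiff x a)\<^sup>2)"
    by (simp only: ereal_less_eq)
  then show ?thesis using kl_ge[OF x a] by (rule order_trans)
qed

lemma lip_feasible_subset:
  assumes \<phi>: "\<phi> \<in> lipschitz_mdps S A lam L L' \<alpha> \<alpha>'" and erg: "ergodic \<phi>"
  shows "lip_feasible L L' \<alpha> \<alpha>' \<phi> \<subseteq> feasible (lipschitz_mdps S A lam L L' \<alpha> \<alpha>') \<phi>"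
proof
  fix \<eta> assume \<eta>: "\<eta> \<in> lip_feasible L L' \<alpha> \<alpha>' \<phi>"
  then have \<eta>0: "\<eta> \<in> states \<phi> \<times> actions \<phi> \<rightarrow>\<^sub>E {0..}" by (simp add: lip_feasible_def)
  then have pos: "0 \<le> \<eta> (x, a)" if "x \<in> states \<phi>" "a \<in> actions \<phi>" for x a using that by auto
  have "1 \<le> (\<Sum>(x, a)\<in>states \<phi> \<times> actions \<phi>. \<eta> (x, a) * kl \<phi> \<psi> x a)"
    if conf: "\<psi> \<in> confusing (lipschitz_mdps S A lam L L' \<alpha> \<alpha>') \<phi>" for \<psi>
  proof -
    have pair: "mdp_pair \<phi> \<psi>" by (rule lipschitz_mdp_pair[OF \<phi> conf])
    then interpret mdp_pair \<phi> \<psi> .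
    have "ergodic_mdp \<phi>" by unfold_locales (rule erg)
    \<comment> \<open>The improved pair selects the one constraint of \<open>lip_feasible\<close>
      that takes care of this \<open>\<psi>\<close>.\<close>
    from confusing_improves_action[OF this pair conf] obtain x' a'
      where x': "x' \<in> states \<phi>" "a' \<in> actions \<phi> - opt_actions \<phi> x'"
        and imp: "gap \<phi> x' a' < bellman \<psi> a' (opt_bias \<phi>) x' - bellman \<phi> a' (opt_bias \<phi>) x'" by blast
    let ?m = "\<lambda>x a. (max 0 (gap \<phi> x' a' / (bias_span \<phi> + 1) - 2 * lip_bound L L' \<alpha> \<alpha>' x a x' a'))\<^sup>2"
    have \<psi>: "\<psi> \<in> lipschitz_mdps S A lam L L' \<alpha> \<alpha>'" using conf by (simp add: confusing_def)
    have "1 \<le> (2 :: ereal)" by simp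
    also have "2 \<le> (\<Sum>x\<in>states \<phi>. \<Sum>a\<in>actions \<phi> - opt_actions \<phi> x. \<eta> (x, a) * ereal (?m x a))"
      using \<eta> x' by (simp add: lip_feasible_def)
    also have "\<dots> \<le> (\<Sum>x\<in>states \<phi>. \<Sum>a\<in>actions \<phi> - opt_actions \<phi> x. \<eta> (x, a) * kl \<phi> \<psi> x a)"
      by (intro sum_mono ereal_mult_left_mono lip_term_le_kl[OF pair \<phi> \<psi>]) (use x' imp pos in auto)
    also have "\<dots> \<le> (\<Sum>x\<in>states \<phi>. \<Sum>a\<in>actions \<phi>. \<eta> (x, a) * kl \<phi> \<psi> x a)"
      by (intro sum_mono sum_mono2) (auto simp: \<phi>.finite_actions pos kl_nonneg)
    also have "\<dots> = (\<Sum>(x, a)\<in>states \<phi> \<times> actions \<phi>. \<eta> (x, a) * kl \<phi> \<psi> x a)"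
      by (rule sum.cartesian_product)
    finally show ?thesis .
  qed
  with \<eta>0 show "\<eta> \<in> feasible (lipschitz_mdps S A lam L L' \<alpha> \<alpha>') \<phi>" by (simp add: feasible_def)
qed

section \<open>Partitions of the cubes and the bound on the optimal values\<close>

text \<open>The cells are the fibres of \<open>c\<close>. If the minimum in
  \<open>cover_size\<close> is the cardinality, they are the single points; otherwise they are cut
  out by a grid of cubes of side \<rho> / sqrt d, whose diameter is \<rho>.\<close>

lemma cube_partition:
  fixes X :: "(real ^ 'n) set"
  assumes ne: "X \<noteq> {}" and X: "X \<subseteq> {x. \<forall>i. 0 \<le> x $ i \<and> x $ i \<le> D}" and \<rho>: "0 < \<rho>"
  obtains c :: "real ^ 'n \<Rightarrow> real ^ 'n" where "real (card (c ` X)) \<le> cover_size (card X) D CARD('n) \<rho>"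
    "\<And>x y. x \<in> X \<Longrightarrow> y \<in> X \<Longrightarrow> c x = c y \<Longrightarrow> dist x y \<le> \<rho>"
proof (cases "real (card X) \<le> (D * sqrt (real CARD('n)) / \<rho> + 1) ^ CARD('n)")
  case True
  then show ?thesis using \<rho> by (intro that[of id]) (auto simp: cover_size_def)
next
  case False
  obtain x where "x \<in> X" using ne by blast
  with X have D: "0 \<le> D" by force
  define s where "s = \<rho> / sqrt (real CARD('n))"
  have s: "0 < s" using \<rho> by (simp add: s_def)
  define c :: "real ^ 'n \<Rightarrow> real ^ 'n" where "c x = (\<chi> i. of_int \<lfloor>x $ i / s\<rfloor>)" for x
  \<comment> \<open>The possible values of one coordinate of \<open>c\<close>. Counting from 0 gives
    floor (D / s) + 1 of them, the origin of the summand 1 in \<open>cover_size\<close>.\<close>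
  define J where "J = (\<lambda>k::nat. real k) ` {..nat \<lfloor>D / s\<rfloor>}"
  have J: "finite J" "card J = nat \<lfloor>D / s\<rfloor> + 1"
    unfolding J_def by (simp, subst card_image) (auto simp: inj_on_def)
  have "(\<lambda>v i. v $ i) ` (c ` X) \<subseteq> PiE UNIV (\<lambda>_. J)"
  proof (clarsimp simp: PiE_iff)
    fix x i assume "x \<in> X"
    then have x: "0 \<le> x $ i" "x $ i \<le> D" using X by auto
    then have "0 \<le> \<lfloor>x $ i / s\<rfloor>" "\<lfloor>x $ i / s\<rfloor> \<le> \<lfloor>D / s\<rfloor>" using s by (auto intro!: floor_mono divide_right_mono)
    then show "c x $ i \<in> J" unfolding J_def c_def
      by (intro image_eqI[of _ _ "nat \<lfloor>x $ i / s\<rfloor>"]) auto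
  qed
  then have "card ((\<lambda>v i. v $ i) ` (c ` X)) \<le> card (PiE (UNIV :: 'n set) (\<lambda>_. J))"
    by (intro card_mono finite_PiE J) simp_all
  also have "\<dots> = (nat \<lfloor>D / s\<rfloor> + 1) ^ CARD('n)" by (simp add: card_PiE J)
  also have "card ((\<lambda>v i. v $ i) ` (c ` X)) = card (c ` X)"
    by (rule card_image) (auto simp: inj_on_def vec_eq_iff fun_eq_iff)
  finally have "real (card (c ` X)) \<le> (real (nat \<lfloor>D / s\<rfloor> + 1)) ^ CARD('n)"
    by (metis of_nat_le_iff of_nat_power)
  also have "\<dots> \<le> (D / s + 1) ^ CARD('n)"
    using D s by (intro power_mono) auto
  also have "D / s = D * sqrt (real CARD('n)) / \<rho>" by (simp add: s_def)
  finally have "real (card (c ` X)) \<le> cover_size (card X) D CARD('n) \<rho>"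
    using False by (simp add: cover_size_def)
  moreover have "dist x y \<le> \<rho>" if "c x = c y" for x y
  proof -
    have "\<bar>x $ i - y $ i\<bar> \<le> s" for i
    proof -
      have "\<lfloor>x $ i / s\<rfloor> = \<lfloor>y $ i / s\<rfloor>" using that by (simp add: c_def vec_eq_iff)
      then have "\<bar>x $ i / s - y $ i / s\<bar> \<le> 1" by linarith
      moreover have "x $ i / s - y $ i / s = (x $ i - y $ i) / s" by (simp add: diff_divide_distrib)
      ultimately show ?thesis using s by (simp add: abs_divide divide_le_eq)
    qed
    then have "dist x y \<le> sqrt (\<Sum>i\<in>(UNIV::'n set). s\<^sup>2)"
      unfolding dist_vec_def L2_set_def dist_real_def
      by (intro real_sqrt_le_mono sum_mono) (simp add: abs_le_square_iff[symmetric] abs_of_pos[OF s])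
    also have "\<dots> = \<rho>" using \<rho> by (simp add: s_def power_divide)
    finally show ?thesis .
  qed
  ultimately show ?thesis by (intro that[of c]) auto
qed

lemma ereal_member_le_sum:
  fixes f :: "'b \<Rightarrow> ereal"
  assumes "i \<in> A" "\<And>x. x \<in> A \<Longrightarrow> 0 \<le> f x" "finite A"
  shows "f i \<le> sum f A"
  using sum_mono2[of A "{i}" f] assms by auto

lemma lip_feasible_representatives:
  assumes proper: "proper_mdp \<phi>" and ne: "pos_gaps \<phi> \<noteq> {}"
    and L: "0 < L" "0 < L'" "0 < \<alpha>" "0 < \<alpha>'"
    and R: "R \<subseteq> states \<phi> \<times> actions \<phi>" "\<And>x a. (x, a) \<in> R \<Longrightarrow> a \<notin> opt_actions \<phi> x"
    and cover: "\<And>x' a'. x' \<in> states \<phi> \<Longrightarrow> a' \<in> actions \<phi> - opt_actions \<phi> x' \<Longrightarrow>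
      \<exists>(x, a)\<in>R. dist x x' \<le> (min_gap \<phi> / (8 * L * (bias_span \<phi> + 1))) powr (1 / \<alpha>) \<and>
        dist a a' \<le> (min_gap \<phi> / (8 * L' * (bias_span \<phi> + 1))) powr (1 / \<alpha>')"
  shows "opt_value \<phi> (lip_feasible L L' \<alpha> \<alpha>' \<phi>)
    \<le> ereal (8 * (bias_span \<phi> + 1) ^ 3 / (min_gap \<phi>)\<^sup>2 * real (card R))"
proof -
  interpret proper_mdp \<phi> by (rule proper)
  let ?H = "bias_span \<phi>" and ?\<delta> = "min_gap \<phi>"
  have H: "0 \<le> ?H" by (rule bias_span_nonneg)
  have \<delta>: "0 < ?\<delta>" by (rule min_gap_pos[OF ne])
  \<comment> \<open>With q = \<delta> / (H + 1), a representative close to the given pair retains a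
    term of at least q / 2 after the Lipschitz correction; \<open>C\<close> solves C * (q / 2)^2 =
    2.\<close>
  define C where "C = 8 * (?H + 1)\<^sup>2 / ?\<delta>\<^sup>2"
  have C: "0 \<le> C" by (simp add: C_def)
  define \<eta> where "\<eta> = restrict (\<lambda>p. if p \<in> R then ereal C else 0) (states \<phi> \<times> actions \<phi>)"
  \<comment> \<open>The radii invert the Hoelder moduli, so that one Lipschitz term is at most q / 8
    within a cell.\<close>
  have pow: "M * r powr b \<le> ?\<delta> / (8 * (?H + 1))"
    if "0 \<le> r" "r \<le> (?\<delta> / (8 * M * (?H + 1))) powr (1 / b)" "0 < M" "0 < b" for M r b :: real
  proof -
    have "r powr b \<le> ((?\<delta> / (8 * M * (?H + 1))) powr (1 / b)) powr b"
      using that by (intro powr_mono2) auto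
    also have "\<dots> = ?\<delta> / (8 * M * (?H + 1))"
      using that H \<delta> by (simp add: powr_powr)
    finally have "M * r powr b \<le> M * (?\<delta> / (8 * M * (?H + 1)))"
      using that by (intro mult_left_mono) auto
    then show ?thesis using that by simp
  qed
  have "\<eta> \<in> lip_feasible L L' \<alpha> \<alpha>' \<phi>"
    unfolding lip_feasible_def
  proof (intro CollectI conjI ballI)
    show "\<eta> \<in> states \<phi> \<times> actions \<phi> \<rightarrow>\<^sub>E {0..}" using C by (auto simp: \<eta>_def)
    fix x' a' assume x': "x' \<in> states \<phi>" "a' \<in> actions \<phi> - opt_actions \<phi> x'"
    let ?m = "\<lambda>x a. (max 0 (gap \<phi> x' a' / (?H + 1) - 2 * lip_bound L L' \<alpha> \<alpha>' x a x' a'))\<^sup>2"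
    obtain x a where xa: "(x, a) \<in> R"
      "dist x x' \<le> (?\<delta> / (8 * L * (?H + 1))) powr (1 / \<alpha>)"
      "dist a a' \<le> (?\<delta> / (8 * L' * (?H + 1))) powr (1 / \<alpha>')"
      using cover[OF x'] by blast
    then have xa': "x \<in> states \<phi>" "a \<in> actions \<phi> - opt_actions \<phi> x" using R by auto
    define q where "q = ?\<delta> / (?H + 1)"
    have "?\<delta> / (8 * (?H + 1)) = q / 8" by (simp add: q_def)
    then have "lip_bound L L' \<alpha> \<alpha>' x a x' a' \<le> q / 8 + q / 8"
      unfolding lip_bound_def using pow xa L by (intro add_mono) (metis zero_le_dist)+
    moreover have "q \<le> gap \<phi> x' a' / (?H + 1)"
      unfolding q_def using min_gap_le[OF x'] H by (intro divide_right_mono) auto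
    ultimately have "q / 2 \<le> gap \<phi> x' a' / (?H + 1) - 2 * lip_bound L L' \<alpha> \<alpha>' x a x' a'"
      by linarith
    then have "q / 2 \<le> max 0 (gap \<phi> x' a' / (?H + 1) - 2 * lip_bound L L' \<alpha> \<alpha>' x a x' a')"
      by (rule max.coboundedI2)
    then have "(q / 2)\<^sup>2 \<le> ?m x a" using \<delta> H by (intro power_mono) (auto simp: q_def)
    then have "C * (q / 2)\<^sup>2 \<le> C * ?m x a" using C by (rule mult_left_mono)
    moreover have "C * (q / 2)\<^sup>2 = 2"
    proof -
      have "(8 * e\<^sup>2 / d\<^sup>2) * (d / e / 2)\<^sup>2 = 2" if "0 < d" "0 < e" for d e :: real
        using that by (simp add: power_divide field_simps)
      from this[of ?\<delta> "?H + 1"] show ?thesis using \<delta> H by (simp add: C_def q_def)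
    qed
    ultimately have "2 \<le> \<eta> (x, a) * ereal (?m x a)"
      using xa xa' by (simp add: \<eta>_def)
    also have "\<dots> \<le> (\<Sum>a\<in>actions \<phi> - opt_actions \<phi> x. \<eta> (x, a) * ereal (?m x a))"
      by (rule ereal_member_le_sum[OF xa'(2)]) (use xa' C finite_actions in \<open>auto simp: \<eta>_def\<close>)
    also have "\<dots> \<le> (\<Sum>x\<in>states \<phi>. \<Sum>a\<in>actions \<phi> - opt_actions \<phi> x. \<eta> (x, a) * ereal (?m x a))"
      by (rule ereal_member_le_sum[OF xa'(1)])
         (use C finite_states in \<open>auto simp: \<eta>_def intro!: sum_nonneg\<close>)
    finally show "2 \<le> (\<Sum>x\<in>states \<phi>. \<Sum>a\<in>actions \<phi> - opt_actions \<phi> x. \<eta> (x, a) * ereal (?m x a))" .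
  qed
  then have "opt_value \<phi> (lip_feasible L L' \<alpha> \<alpha>' \<phi>)
      \<le> (\<Sum>(x, a)\<in>states \<phi> \<times> actions \<phi>. \<eta> (x, a) * ereal (gap \<phi> x a))"
    unfolding opt_value_def by (rule INF_lower)
  also have "\<dots> = (\<Sum>(x, a)\<in>R. ereal (C * gap \<phi> x a))"
    using R finite_states finite_actions
    by (intro sum.mono_neutral_cong_right) (auto simp: \<eta>_def)
  also have "\<dots> = ereal (\<Sum>(x, a)\<in>R. C * gap \<phi> x a)"
    by (simp add: case_prod_beta)
  \<comment> \<open>Each gap is at most H + 1, which supplies the third power.\<close>
  also have "(\<Sum>(x, a)\<in>R. C * gap \<phi> x a) \<le> (\<Sum>(x, a)\<in>R. C * (?H + 1))"
    using R(1) C by (intro sum_mono) (auto intro!: mult_left_mono gap_le)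
  also have "\<dots> = 8 * (?H + 1) ^ 3 / ?\<delta>\<^sup>2 * real (card R)"
    by (simp add: C_def power2_eq_square power3_eq_cube)
  finally show ?thesis by simp
qed

lemma lip_value_bound:
  fixes \<phi> :: "('s::metric_space, 'a::metric_space) mdp"
  assumes proper: "proper_mdp \<phi>" and ne: "pos_gaps \<phi> \<noteq> {}"
    and L: "0 < L" "0 < L'" "0 < \<alpha>" "0 < \<alpha>'"
    and c: "\<And>x y. x \<in> states \<phi> \<Longrightarrow> y \<in> states \<phi> \<Longrightarrow> c x = c y \<Longrightarrow>
      dist x y \<le> (min_gap \<phi> / (8 * L * (bias_span \<phi> + 1))) powr (1 / \<alpha>)"
    and c': "\<And>a b. a \<in> actions \<phi> \<Longrightarrow> b \<in> actions \<phi> \<Longrightarrow> c' a = c' b \<Longrightarrow>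
      dist a b \<le> (min_gap \<phi> / (8 * L' * (bias_span \<phi> + 1))) powr (1 / \<alpha>')"
  shows "opt_value \<phi> (lip_feasible L L' \<alpha> \<alpha>' \<phi>)
    \<le> ereal (8 * (bias_span \<phi> + 1) ^ 3 / (min_gap \<phi>)\<^sup>2 * real (card (c ` states \<phi>)) * real (card (c' ` actions \<phi>)))"
proof -
  interpret proper_mdp \<phi> by (rule proper)
  define B where "B = (SIGMA x:states \<phi>. actions \<phi> - opt_actions \<phi> x)"
  define key where "key = map_prod c c'"
  \<comment> \<open>One representative per nonempty cell, chosen inside \<open>B\<close> so that it
    is suboptimal itself. Cells are formed on pairs because the set of suboptimal actions varies
    with the state.\<close>
  define R where "R = inv_into B key ` key ` B"
  have RB: "R \<subseteq> B" by (auto simp: R_def inv_into_into)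
  have "opt_value \<phi> (lip_feasible L L' \<alpha> \<alpha>' \<phi>)
    \<le> ereal (8 * (bias_span \<phi> + 1) ^ 3 / (min_gap \<phi>)\<^sup>2 * real (card R))"
  proof (rule lip_feasible_representatives[OF proper ne L])
    show "R \<subseteq> states \<phi> \<times> actions \<phi>" "\<And>x a. (x, a) \<in> R \<Longrightarrow> a \<notin> opt_actions \<phi> x"
      using RB by (auto simp: B_def)
    fix x' a' assume "x' \<in> states \<phi>" "a' \<in> actions \<phi> - opt_actions \<phi> x'"
    then have B: "(x', a') \<in> B" by (simp add: B_def)
    let ?p = "inv_into B key (key (x', a'))"
    have p: "?p \<in> R" "key ?p = key (x', a')" using B by (auto simp: R_def f_inv_into_f)
    then have "fst ?p \<in> states \<phi>" "snd ?p \<in> actions \<phi>" "c (fst ?p) = c x'" "c' (snd ?p) = c' a'"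
      using RB by (auto simp: B_def key_def map_prod_def split: prod.splits)
    then show "\<exists>(x, a)\<in>R. dist x x' \<le> (min_gap \<phi> / (8 * L * (bias_span \<phi> + 1))) powr (1 / \<alpha>) \<and>
        dist a a' \<le> (min_gap \<phi> / (8 * L' * (bias_span \<phi> + 1))) powr (1 / \<alpha>')"
      using p(1) B by (intro bexI[of _ ?p]) (auto simp: B_def case_prod_beta intro!: c c')
  qed
  also have "\<dots> \<le> ereal (8 * (bias_span \<phi> + 1) ^ 3 / (min_gap \<phi>)\<^sup>2 *
      real (card (c ` states \<phi> \<times> c' ` actions \<phi>)))"
  proof -
    have fin: "finite (c ` states \<phi> \<times> c' ` actions \<phi>)" using finite_states finite_actions by simp
    have sub: "key ` B \<subseteq> c ` states \<phi> \<times> c' ` actions \<phi>" by (auto simp: key_def B_def)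
    have "card R \<le> card (key ` B)" unfolding R_def by (rule card_image_le[OF finite_subset[OF sub fin]])
    also have "\<dots> \<le> card (c ` states \<phi> \<times> c' ` actions \<phi>)" by (rule card_mono[OF fin sub])
    finally show ?thesis
      using bias_span_nonneg unfolding ereal_less_eq by (intro mult_left_mono) auto
  qed
  finally show ?thesis by (simp add: card_cartesian_product mult_ac)
qed

theorem theorem3:
  fixes S :: "(real ^ 'd) set" and A :: "(real ^ 'e) set" and lam :: "real measure"
    and D D' L L' \<alpha> \<alpha>' :: real
    and \<phi> :: "(real ^ 'd, real ^ 'e) mdp"
  defines "\<Phi> \<equiv> lipschitz_mdps S A lam L L' \<alpha> \<alpha>'"
    and "H \<equiv> bias_span \<phi>"
    and "\<delta>min \<equiv> min_gap \<phi>"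
  defines "S_lip \<equiv> cover_size (card S) D CARD('d) ((\<delta>min / (8 * L * (H + 1))) powr (1 / \<alpha>))"
    and "A_lip \<equiv> cover_size (card A) D' CARD('e) ((\<delta>min / (8 * L' * (H + 1))) powr (1 / \<alpha>'))"
  assumes "finite S" "S \<subseteq> {x. \<forall>i. 0 \<le> x $ i \<and> x $ i \<le> D}"
    and "finite A" "A \<subseteq> {a. \<forall>i. 0 \<le> a $ i \<and> a $ i \<le> D'}"
    and "L > 0" "L' > 0" "\<alpha> > 0" "\<alpha>' > 0"
    and "\<phi> \<in> \<Phi>" and "ergodic \<phi>"
  shows "lip_feasible L L' \<alpha> \<alpha>' \<phi> \<subseteq> feasible \<Phi> \<phi> \<and>
    (pos_gaps \<phi> \<noteq> {} \<longrightarrow>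
       opt_value \<phi> (feasible \<Phi> \<phi>) \<le> ereal (8 * (H + 1) ^ 3 / \<delta>min\<^sup>2 * S_lip * A_lip) \<and>
       opt_value \<phi> (lip_feasible L L' \<alpha> \<alpha>' \<phi>)
         \<le> ereal (8 * (H + 1) ^ 3 / \<delta>min\<^sup>2 * S_lip * A_lip))"
proof (intro conjI impI)
  have proper: "proper_mdp \<phi>" and SA: "states \<phi> = S" "actions \<phi> = A"
    using \<open>\<phi> \<in> \<Phi>\<close> by (auto simp: \<Phi>_def lipschitz_mdps_def proper_mdp_def)
  then interpret proper_mdp \<phi> by simp
  show sub: "lip_feasible L L' \<alpha> \<alpha>' \<phi> \<subseteq> feasible \<Phi> \<phi>"
    unfolding \<Phi>_def by (rule lip_feasible_subset) (use assms in auto)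
  assume ne: "pos_gaps \<phi> \<noteq> {}"
  have H: "0 \<le> H" unfolding H_def by (rule bias_span_nonneg)
  have \<delta>: "0 < \<delta>min" unfolding \<delta>min_def by (rule min_gap_pos[OF ne])
  have \<rho>: "0 < (\<delta>min / (8 * L * (H + 1))) powr (1 / \<alpha>)" "0 < (\<delta>min / (8 * L' * (H + 1))) powr (1 / \<alpha>')"
    using H \<delta> \<open>L > 0\<close> \<open>L' > 0\<close> by simp_all
  obtain c :: "real ^ 'd \<Rightarrow> real ^ 'd" where c: "real (card (c ` S)) \<le> S_lip"
    "\<And>x y. x \<in> S \<Longrightarrow> y \<in> S \<Longrightarrow> c x = c y \<Longrightarrow> dist x y \<le> (\<delta>min / (8 * L * (H + 1))) powr (1 / \<alpha>)"
    using cube_partition[OF _ \<open>S \<subseteq> _\<close> \<rho>(1)] states_nonempty SA unfolding S_lip_def by metis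
  obtain c' :: "real ^ 'e \<Rightarrow> real ^ 'e" where c': "real (card (c' ` A)) \<le> A_lip"
    "\<And>x y. x \<in> A \<Longrightarrow> y \<in> A \<Longrightarrow> c' x = c' y \<Longrightarrow> dist x y \<le> (\<delta>min / (8 * L' * (H + 1))) powr (1 / \<alpha>')"
    using cube_partition[OF _ \<open>A \<subseteq> _\<close> \<rho>(2)] actions_nonempty SA unfolding A_lip_def by metis
  have "opt_value \<phi> (lip_feasible L L' \<alpha> \<alpha>' \<phi>)
      \<le> ereal (8 * (H + 1) ^ 3 / \<delta>min\<^sup>2 * real (card (c ` S)) * real (card (c' ` A)))"
    unfolding H_def \<delta>min_def SA[symmetric]
    by (rule lip_value_bound[OF proper ne]) (use assms c c' SA in auto)
  also have "\<dots> \<le> ereal (8 * (H + 1) ^ 3 / \<delta>min\<^sup>2 * S_lip * A_lip)"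
    \<comment> \<open>Monotonicity of the product requires \<open>S_lip\<close> to be nonnegative,
      which follows from its lying above a cardinality.\<close>
    using H c(1) c'(1) order_trans[OF of_nat_0_le_iff c(1)]
    unfolding ereal_less_eq by (intro mult_mono) auto
  finally show lip: "opt_value \<phi> (lip_feasible L L' \<alpha> \<alpha>' \<phi>) \<le> ereal (8 * (H + 1) ^ 3 / \<delta>min\<^sup>2 * S_lip * A_lip)" .
  \<comment> \<open>The inclusion just proved compares the infima, so one bound serves both
    values.\<close>
  have "opt_value \<phi> (feasible \<Phi> \<phi>) \<le> opt_value \<phi> (lip_feasible L L' \<alpha> \<alpha>' \<phi>)"
    unfolding opt_value_def by (rule INF_superset_mono[OF sub order_refl])
  with lip show "opt_value \<phi> (feasible \<Phi> \<phi>) \<le> ereal (8 * (H + 1) ^ 3 / \<delta>min\<^sup>2 * S_lip * A_lip)"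
    by (rule order_trans[rotated])
qed

end
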